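(* Let $\Sigma\times\Gamma$ be the networked mass-spring-damper system defined in the context. The following are equivalent: (i) Every output trajectory $y(t)$ of $\Sigma\times\Gamma$ converges, as $t\to\infty$, to a point in $\operatorname{im}(\mathbb{I}_r)$. (ii) None of the eigenvectors of $M_u^{-1}\tilde{\mathbb{L}}_u$ is contained in the intersection of the kernel of $\mathbb{L}_{du}$ and the kernel of $R_u$, i.e. for each $\mu\in\sigma(M_u^{-1}\tilde{\mathbb{L}}_u)$: $$\ker(M_u^{-1}\tilde{\mathbb{L}}_u-\mu I)\cap\ker\begin{pmatrix}\mathbb{L}_{du}\\ R_u\end{pmatrix}=\{0\}.$$ (iii) Every eigenvector of $M^{-1}\mathbb{L}$ in the kernel of $R$ has at least one nonzero value in an entry that corresponds to a damped node, i.e. for each $\mu\in\sigma(M^{-1}\mathbb{L})$: $$\ker(M^{-1}\mathbb{L}-\mu I)\cap\ker(R)\cap\operatorname{im}\begin{pmatrix}0_{n_dr\times n_ur}\\ I_{n_ur}\end{pmatrix}=\{0\}.$$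
   Context: Setting. $\mathcal{G}=(V,E)$ is a finite connected undirected graph with $n$ nodes and $m$ edges; $B\in\mathbb{R}^{n\times m}$ is an oriented incidence matrix (each column has exactly one $1$ and one $-1$, in the rows of the endpoints of the edge, and zeros elsewhere). Fix an integer $r\ge1$ and put $\mathbb{B}=B\otimes I_r$ and $\mathbb{I}_r=\mathbf{1}\otimes I_r$, where $\mathbf 1\in\mathbb{R}^n$ is the all-ones vector. The parameters are block diagonal matrices with $r\times r$ blocks: $M=\mathrm{diag}(M_1,\dots,M_n)$, $R=\mathrm{diag}(R_1,\dots,R_n)$, $W=\mathrm{diag}(W_1,\dots,W_m)$, with $M_i\succ0$, $R_i\succcurlyeq0$, $W_k\succ0$ (positive (semi)definite matrices are symmetric), and a constant vector $v\in\mathbb{R}^{rn}$. A node $i$ is damped if $R_i\succ0$, and otherwise ($R_i$ singular, possibly zero) it is called (partially) undamped. $V_d$ is the set of damped nodes, $n_d=|V_d|\ge1$; $V_u=V\setminus V_d$, $n_u=|V_u|\ge0$. Nodes are ordered with the damped nodes first. The system $\Sigma\times\Gamma$, with state $(p,q)\in\mathbb{R}^{rn}\times\mathbb{R}^{rm}$ (arbitrary initial conditions), is $$\dot p=-RM^{-1}p-\mathbb{B}Wq+v,\qquad \dot q=\mathbb{B}^TM^{-1}p,\qquad y=M^{-1}p .$$ Decompose $M=\mathrm{diag}(M_d,M_u)$, $R=\mathrm{diag}(R_d,R_u)$ and $\mathbb{B}=\begin{pmatrix}\mathbb{B}_d\\ \mathbb{B}_u\end{pmatrix}$ according to damped/undamped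 nodes. Let $\mathbb{L}=\mathbb{B}W\mathbb{B}^T$, with blocks $\mathbb{L}_{dd}=\mathbb{B}_dW\mathbb{B}_d^T$, $\mathbb{L}_{du}=\mathbb{B}_dW\mathbb{B}_u^T$, $\mathbb{L}_{uu}=\mathbb{B}_uW\mathbb{B}_u^T$, and let $$\tilde{\mathbb{L}}_u=\mathbb{L}_{uu}-\mathbb{L}_{du}^T\,\mathbb{L}_{dd}^{-1}\,\mathbb{L}_{du}.$$ (In the degenerate case $n_u=0$ all matrices with subscript $u$ are empty.) $\sigma(\cdot)$ denotes the spectrum. *)

theory Defs
  imports Complex_Main "Jordan_Normal_Form.Matrix" "Jordan_Normal_Form.Gauss_Jordan_Elimination"
    "Jordan_Normal_Form.Matrix_Kernel" "Jordan_Normal_Form.Spectral_Radius"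
begin

definition connected_graph :: "'a set \<Rightarrow> 'a set set \<Rightarrow> bool" where
  "connected_graph V E \<longleftrightarrow>
     finite V \<and> V \<noteq> {} \<and> (\<forall>e\<in>E. e \<subseteq> V \<and> card e = 2) \<and>
     (\<forall>u\<in>V. \<forall>w\<in>V. (u, w) \<in> {(a, b). {a, b} \<in> E}\<^sup>*)"

text \<open>The list \<open>es\<close> enumerates the edges; column \<open>k\<close> of the matrix belongs to the edge \<open>es ! k\<close>,
  whose orientation is arbitrary.\<close>

definition oriented_incidence_mat :: "nat \<Rightarrow> nat set list \<Rightarrow> real mat \<Rightarrow> bool" where
  "oriented_incidence_mat n es B \<longleftrightarrow>
     B \<in> carrier_mat n (length es) \<and>
     (\<forall>k<length es. \<exists>i j. i \<noteq> j \<and> es ! k = {i, j} \<and> B $$ (i, k) = 1 \<and> B $$ (j, k) = -1 \<and>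
        (\<forall>l<n. l \<noteq> i \<and> l \<noteq> j \<longrightarrow> B $$ (l, k) = 0))"

definition kronecker_mat :: "'a::semiring_1 mat \<Rightarrow> 'a mat \<Rightarrow> 'a mat" (infixl "\<otimes>\<^sub>K" 70) where
  "A \<otimes>\<^sub>K B = mat (dim_row A * dim_row B) (dim_col A * dim_col B)
     (\<lambda>(i, j). A $$ (i div dim_row B, j div dim_col B) * B $$ (i mod dim_row B, j mod dim_col B))"

definition pos_semidef_mat :: "nat \<Rightarrow> real mat \<Rightarrow> bool" where
  "pos_semidef_mat k A \<longleftrightarrow> A \<in> carrier_mat k k \<and> A\<^sup>T = A \<and>
     (\<forall>x\<in>carrier_vec k. 0 \<le> x \<bullet> (A *\<^sub>v x))"

definition pos_def_mat :: "nat \<Rightarrow> real mat \<Rightarrow> bool" where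
  "pos_def_mat k A \<longleftrightarrow> A \<in> carrier_mat k k \<and> A\<^sup>T = A \<and>
     (\<forall>x\<in>carrier_vec k. x \<noteq> 0\<^sub>v k \<longrightarrow> 0 < x \<bullet> (A *\<^sub>v x))"

text \<open>Only meaningful for an invertible argument; for a singular one the value is unspecified.\<close>

definition minv :: "'a::field mat \<Rightarrow> 'a mat" where
  "minv A = the (mat_inverse A)"

definition mat_image :: "'a::comm_ring_1 mat \<Rightarrow> 'a vec set" where
  "mat_image A = (\<lambda>x. A *\<^sub>v x) ` carrier_vec (dim_col A)"

text \<open>Spectra of real matrices, and the corresponding kernels, are taken over the complex numbers.\<close>

abbreviation cmat :: "real mat \<Rightarrow> complex mat" where
  "cmat \<equiv> map_mat complex_of_real"

text \<open>The type \<^typ>\<open>real vec\<close> has no topology, so limits and derivatives of curves with values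
  in a fixed \<^term>\<open>carrier_vec k\<close> are taken entrywise.\<close>

definition tendsto_vec :: "('a \<Rightarrow> real vec) \<Rightarrow> real vec \<Rightarrow> 'a filter \<Rightarrow> bool" where
  "tendsto_vec f l F \<longleftrightarrow> (\<forall>\<^sub>F x in F. dim_vec (f x) = dim_vec l) \<and>
     (\<forall>i<dim_vec l. ((\<lambda>x. f x $ i) \<longlongrightarrow> l $ i) F)"

definition has_deriv_vec :: "(real \<Rightarrow> real vec) \<Rightarrow> real vec \<Rightarrow> real filter \<Rightarrow> bool" where
  "has_deriv_vec f d F \<longleftrightarrow> (\<forall>i<dim_vec d. ((\<lambda>t. f t $ i) has_real_derivative d $ i) F)"

text \<open>Solutions on \<open>[0, \<infinity>)\<close>, with arbitrary initial condition, of
  \<open>p' = - R M\<^sup>-\<^sup>1 p - B W q + v\<close>, \<open>q' = B\<^sup>T M\<^sup>-\<^sup>1 p\<close>; here \<open>B\<close> is the Kronecker-extended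
  incidence matrix.\<close>

definition msd_solution ::
  "real mat \<Rightarrow> real mat \<Rightarrow> real mat \<Rightarrow> real mat \<Rightarrow> real vec \<Rightarrow>
   (real \<Rightarrow> real vec) \<Rightarrow> (real \<Rightarrow> real vec) \<Rightarrow> bool" where
  "msd_solution M R W B v p q \<longleftrightarrow>
     (\<forall>t\<ge>0. p t \<in> carrier_vec (dim_row B) \<and> q t \<in> carrier_vec (dim_col B) \<and>
        has_deriv_vec p (- (R *\<^sub>v (minv M *\<^sub>v p t)) - B *\<^sub>v (W *\<^sub>v q t) + v) (at t within {0..}) \<and>
        has_deriv_vec q (B\<^sup>T *\<^sub>v (minv M *\<^sub>v p t)) (at t within {0..}))"

end

(*
  Shifting by an equilibrium makes the system homogeneous. The energy y.My + q.Wq is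
  nonincreasing with derivative -2 y.Ry, so all linear functionals of (y, q), and with them all
  their derivatives, are bounded. Barbalat's lemma then gives y.Ry -> 0, hence s.y -> 0 for s in
  the range of R, and the set of s with s.y -> 0 is closed under s |-> L M^-1 s. A nonzero cluster
  point of y is orthogonal to that set, so the orthogonal complement is a nonzero M^-1 L-invariant
  subspace of ker R and contains an eigenvector of M^-1 L. Conversely, an eigenvector of M^-1 L in
  ker R gives a real w with L w = c M w, c > 0, R w = 0, and y = y0 + sin (sqrt c * t) w is an
  output that does not converge. Vectors in ker R vanish on the damped nodes, which turns
  eigenvectors of M^-1 L in ker R into eigenvectors of the Schur complement pencil in
  ker L_du and ker R_u.
*)

theory Submission
  imports Defs "HOL-Computational_Algebra.Fundamental_Theorem_Algebra"
begin

subsection \<open>Eigenvectors in invariant subspaces\<close>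

text \<open>Three links carry the weight of the sketch. An equilibrium exists for arbitrary
  \<open>v\<close> because a vector that is equal at all nodes and dissipates nothing is zero: it
  repeats one block of \<open>r\<close> entries, and the damped node 0 kills that block. The same
  fact gives \<open>c > 0\<close>, since \<open>B\<^sup>T w = 0\<close> together with
  \<open>R w = 0\<close> would force \<open>w = 0\<close>. Next, boundedness by itself gives
  \<open>y\<close> no limit. A cluster point turns failure of convergence into a fixed vector, after
  which only linear algebra remains: the annihilator of the decaying functionals is invariant
  because \<open>M\<^sup>-\<^sup>1 L\<close> is the transpose of \<open>L M\<^sup>-\<^sup>1\<close>.
  Finally, the spectra are complex while the motion is real. Eigenvectors are found over the complex
  numbers, where polynomials split; symmetry of \<open>M\<close> and \<open>L\<close> makes their
  eigenvalues real, so that a real oscillation can be read off. Conditions (i), (ii) and (iii) are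
  each compared with one predicate, the absence of eigenvectors of
  \<open>M\<^sup>-\<^sup>1 L\<close> in the kernel of \<open>R\<close>.\<close>

lemma minv_inverts:
  fixes A :: "'a::field mat"
  assumes A: "A \<in> carrier_mat n n"
    and inj: "\<And>x. x \<in> carrier_vec n \<Longrightarrow> A *\<^sub>v x = 0\<^sub>v n \<Longrightarrow> x = 0\<^sub>v n"
  shows "minv A \<in> carrier_mat n n" "A * minv A = 1\<^sub>m n" "minv A * A = 1\<^sub>m n"
proof -
  have "det A \<noteq> 0" using det_0_iff_vec_prod_zero[OF A] inj by blast
  then have "A \<in> Units (ring_mat TYPE('a) n ())" by (rule det_non_zero_imp_unit[OF A])
  then obtain B where B: "mat_inverse A = Some B"
    using mat_inverse(1)[OF A, of "()"] by (cases "mat_inverse A") auto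
  show "minv A \<in> carrier_mat n n" "A * minv A = 1\<^sub>m n" "minv A * A = 1\<^sub>m n"
    using mat_inverse(2)[OF A B] B by (simp_all add: minv_def)
qed

lemma minv_mult_vec:
  fixes A :: "'a::field mat"
  assumes A: "A \<in> carrier_mat n n"
    and inj: "\<And>x. x \<in> carrier_vec n \<Longrightarrow> A *\<^sub>v x = 0\<^sub>v n \<Longrightarrow> x = 0\<^sub>v n"
    and x: "x \<in> carrier_vec n"
  shows "A *\<^sub>v (minv A *\<^sub>v x) = x" "minv A *\<^sub>v (A *\<^sub>v x) = x"
proof -
  note m = minv_inverts[OF A inj]
  show "A *\<^sub>v (minv A *\<^sub>v x) = x"
    using assoc_mult_mat_vec[OF A m(1) x] m(2) x by simp
  show "minv A *\<^sub>v (A *\<^sub>v x) = x"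
    using assoc_mult_mat_vec[OF m(1) A x] m(3) x by simp
qed

text \<open>This is \<open>f(A) z\<close>, evaluated by Horner's scheme directly on vectors, so that
  no powers of \<open>A\<close> have to be formed.\<close>

definition poly_mat_vec :: "'a::field mat \<Rightarrow> 'a poly \<Rightarrow> 'a vec \<Rightarrow> 'a vec" where
  "poly_mat_vec A f z = fold_coeffs (\<lambda>c w. c \<cdot>\<^sub>v z + A *\<^sub>v w) f (0\<^sub>v (dim_vec z))"

context
  fixes A :: "'a::field mat" and n :: nat and z :: "'a vec"
  assumes A: "A \<in> carrier_mat n n" and z: "z \<in> carrier_vec n"
begin

lemma poly_mat_vec_0: "poly_mat_vec A 0 z = 0\<^sub>v n"
  using z by (simp add: poly_mat_vec_def)

lemma poly_mat_vec_pCons: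
  "poly_mat_vec A (pCons c f) z = c \<cdot>\<^sub>v z + A *\<^sub>v poly_mat_vec A f z"
proof (cases "c = 0 \<and> f = 0")
  case True
  have "A *\<^sub>v 0\<^sub>v n = 0\<^sub>v n" using A by (intro eq_vecI) auto
  moreover have "(0::'a) \<cdot>\<^sub>v z = 0\<^sub>v n" using z by (intro eq_vecI) auto
  ultimately show ?thesis using True A z by (simp add: poly_mat_vec_0)
qed (auto simp: poly_mat_vec_def)

lemma poly_mat_vec_carrier: "poly_mat_vec A f z \<in> carrier_vec n"
  by (induction f) (use A z in \<open>auto simp: poly_mat_vec_0 poly_mat_vec_pCons\<close>)

lemma poly_mat_vec_add:
  "poly_mat_vec A (f + g) z = poly_mat_vec A f z + poly_mat_vec A g z"
proof (induction f g rule: poly_induct2)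
  case (pCons a p b q)
  note c = poly_mat_vec_carrier[of p] poly_mat_vec_carrier[of q]
  have "A *\<^sub>v (poly_mat_vec A p z + poly_mat_vec A q z)
      = A *\<^sub>v poly_mat_vec A p z + A *\<^sub>v poly_mat_vec A q z"
    using mult_add_distrib_mat_vec[OF A c] .
  then show ?case using A z c pCons
    by (intro eq_vecI) (auto simp: poly_mat_vec_pCons algebra_simps)
qed (simp add: poly_mat_vec_0)

lemma poly_mat_vec_smult: "poly_mat_vec A (smult a f) z = a \<cdot>\<^sub>v poly_mat_vec A f z"
proof (induction f)
  case (pCons b p)
  note c = poly_mat_vec_carrier[of p]
  have "A *\<^sub>v (a \<cdot>\<^sub>v poly_mat_vec A p z) = a \<cdot>\<^sub>v (A *\<^sub>v poly_mat_vec A p z)"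
    using mult_mat_vec[OF A c] .
  then show ?case using A z c pCons
    by (intro eq_vecI) (auto simp: poly_mat_vec_pCons algebra_simps)
qed (auto simp: poly_mat_vec_0 intro!: eq_vecI)

text \<open>Read as \<open>(A - a) (f(A) z)\<close>: if the product polynomial annihilates
  \<open>z\<close>, then \<open>f(A) z\<close> is either zero or an eigenvector for
  \<open>a\<close>. This drives the eigenvector search below.\<close>

lemma poly_mat_vec_linear_factor:
  "poly_mat_vec A ([:-a, 1:] * f) z = A *\<^sub>v poly_mat_vec A f z - a \<cdot>\<^sub>v poly_mat_vec A f z"
proof -
  have "[:-a, 1:] * f = smult (-a) f + pCons 0 f" by simp
  then show ?thesis using A z poly_mat_vec_carrier[of f]
    by (intro eq_vecI)
      (auto simp: poly_mat_vec_pCons poly_mat_vec_add poly_mat_vec_smult simp del: mult_pCons_left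
        smult_minus_left add_uminus_conv_diff)
qed

lemma poly_mat_vec_monom: "poly_mat_vec A (monom c k) z = c \<cdot>\<^sub>v poly_mat_vec A (monom 1 k) z"
  using poly_mat_vec_smult[of c "monom 1 k"] by (simp add: smult_monom)

lemma poly_mat_vec_sum:
  "i < n \<Longrightarrow> poly_mat_vec A (\<Sum>k<(l::nat). f k) z $ i = (\<Sum>k<l. poly_mat_vec A (f k) z $ i)"
proof (induction l)
  case (Suc l)
  then show ?case using poly_mat_vec_carrier[of "f l"] by (simp add: poly_mat_vec_add)
qed (simp add: poly_mat_vec_0)

lemma poly_mat_vec_in_subspace:
  assumes "z \<in> S" "\<And>x. x \<in> S \<Longrightarrow> A *\<^sub>v x \<in> S" "\<And>x y. x \<in> S \<Longrightarrow> y \<in> S \<Longrightarrow> x + y \<in> S"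
    "\<And>c x. x \<in> S \<Longrightarrow> c \<cdot>\<^sub>v x \<in> S"
  shows "poly_mat_vec A f z \<in> S"
proof (induction f)
  case 0
  have "(0::'a) \<cdot>\<^sub>v z = 0\<^sub>v n" using z by (intro eq_vecI) auto
  then show ?case using assms(1,4) by (metis poly_mat_vec_0)
qed (use assms in \<open>simp add: poly_mat_vec_pCons\<close>)

end

text \<open>The vectors \<open>A\<^sup>k z\<close>, \<open>k \<le> n\<close>, padded with a zero row, form a singular square matrix.\<close>

lemma exists_annihilating_poly:
  fixes A :: "'a::field mat"
  assumes A: "A \<in> carrier_mat n n" and z: "z \<in> carrier_vec n"
  shows "\<exists>f. f \<noteq> 0 \<and> poly_mat_vec A f z = 0\<^sub>v n"
proof -
  define C where "C = mat (Suc n) (Suc n)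
    (\<lambda>(i, k). if i < n then poly_mat_vec A (monom 1 k) z $ i else 0)"
  have C: "C \<in> carrier_mat (Suc n) (Suc n)" by (simp add: C_def)
  have "C\<^sup>T *\<^sub>v unit_vec (Suc n) n = 0\<^sub>v (Suc n)"
    using C by (intro eq_vecI) (auto simp: C_def scalar_prod_def)
  moreover have "(unit_vec (Suc n) n :: 'a vec) \<noteq> 0\<^sub>v (Suc n)"
    by (metis index_unit_vec(1) index_zero_vec(1) lessI zero_neq_one)
  ultimately have "det (C\<^sup>T) = 0"
    using C det_0_iff_vec_prod_zero[of "C\<^sup>T" "Suc n"] by (metis transpose_carrier_mat unit_vec_carrier)
  then have "det C = 0" using det_transpose[OF C] by simp
  \<comment> \<open>A kernel vector of \<open>C\<close> is a linear dependence among the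
    \<open>n + 1\<close> vectors \<open>A^k z\<close> of length \<open>n\<close>; its entries become
    the coefficients of the polynomial.\<close>
  then obtain c where c: "c \<in> carrier_vec (Suc n)" "c \<noteq> 0\<^sub>v (Suc n)" "C *\<^sub>v c = 0\<^sub>v (Suc n)"
    using det_0_iff_vec_prod_zero[OF C] by auto
  define f where "f = (\<Sum>k<Suc n. monom (c $ k) k)"
  have coeff: "coeff f k = c $ k" if "k < Suc n" for k
    using that by (auto simp: f_def coeff_sum if_distrib sum.delta' cong: if_cong simp del: sum.lessThan_Suc)
  obtain k where "k < Suc n" "c $ k \<noteq> 0" using c(1,2)
    by (metis carrier_vecD eq_vecI index_zero_vec)
  then have "f \<noteq> 0" using coeff[of k] by auto
  moreover have "poly_mat_vec A f z = 0\<^sub>v n"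
  proof (intro eq_vecI)
    fix i assume "i < dim_vec (0\<^sub>v n :: 'a vec)"
    then have i: "i < n" by simp
    have "poly_mat_vec A f z $ i = (\<Sum>k<Suc n. C $$ (i, k) * c $ k)"
      unfolding f_def poly_mat_vec_sum[OF A z i]
    proof (rule sum.cong[OF refl])
      fix k assume "k \<in> {..<Suc n}"
      then show "poly_mat_vec A (monom (c $ k) k) z $ i = C $$ (i, k) * c $ k"
        using i poly_mat_vec_carrier[OF A z, of "monom 1 k"]
        by (subst poly_mat_vec_monom[OF A z]) (auto simp: C_def)
    qed
    also have "\<dots> = (C *\<^sub>v c) $ i"
      using C c(1) i by (auto simp: scalar_prod_def atLeast0LessThan)
    finally show "poly_mat_vec A f z $ i = 0\<^sub>v n $ i" using c(3) i by simp
  qed (use poly_mat_vec_carrier[OF A z] in auto)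
  ultimately show ?thesis by blast
qed

text \<open>Linear factors are split off an annihilating polynomial of \<open>z\<close>. Either the
  cofactor \<open>h\<close> still annihilates \<open>z\<close> and has smaller degree, or
  \<open>h(A) z\<close> is an eigenvector. A nonzero constant cannot annihilate \<open>z\<close>, so
  the second case must occur, and \<open>h(A) z\<close> stays in \<open>S\<close> because
  \<open>S\<close> is closed under \<open>A\<close> and linear combinations.\<close>

lemma invariant_subspace_eigenvector:
  fixes A :: "complex mat"
  assumes A: "A \<in> carrier_mat n n" and z: "z \<in> carrier_vec n" "z \<noteq> 0\<^sub>v n"
    and S: "z \<in> S" "\<And>x. x \<in> S \<Longrightarrow> A *\<^sub>v x \<in> S" "\<And>x y. x \<in> S \<Longrightarrow> y \<in> S \<Longrightarrow> x + y \<in> S"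
    "\<And>c x. x \<in> S \<Longrightarrow> c \<cdot>\<^sub>v x \<in> S"
  shows "\<exists>\<mu> w. w \<in> S \<and> w \<in> carrier_vec n \<and> w \<noteq> 0\<^sub>v n \<and> A *\<^sub>v w = \<mu> \<cdot>\<^sub>v w"
proof -
  note c = poly_mat_vec_carrier[OF A z(1)]
  have "?thesis" if "f \<noteq> 0" "poly_mat_vec A f z = 0\<^sub>v n" for f
    using that
  proof (induction "degree f" arbitrary: f)
    case 0
    then obtain a where f: "f = [:a:]" by (metis degree_eq_zeroE)
    have "poly_mat_vec A f z = a \<cdot>\<^sub>v z" using A z(1)
      by (intro eq_vecI) (auto simp: f poly_mat_vec_pCons[OF A z(1)] poly_mat_vec_0[OF A z(1)])
    moreover have "a \<noteq> 0" using 0 f by auto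
    ultimately have "z = 0\<^sub>v n" using 0 z(1)
      by (intro eq_vecI) (auto, metis carrier_vecD index_smult_vec(1) index_zero_vec(1) mult_eq_0_iff)
    then show ?case using z by simp
  next
    case (Suc d)
    then have "\<not> constant (poly f)" by (simp add: constant_degree)
    then obtain a where "poly f a = 0" using fundamental_theorem_of_algebra by blast
    then obtain h where h: "f = [:-a, 1:] * h" by (auto simp: poly_eq_0_iff_dvd)
    have h0: "h \<noteq> 0" using h Suc.prems by auto
    let ?w = "poly_mat_vec A h z"
    show ?case
    proof (cases "?w = 0\<^sub>v n")
      case True
      have "degree f = Suc (degree h)" unfolding h using h0 by (subst degree_mult_eq) auto
      then show ?thesis using Suc.hyps True h0 by auto
    next
      case False
      have "A *\<^sub>v ?w - a \<cdot>\<^sub>v ?w = 0\<^sub>v n"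
        using Suc.prems(2) poly_mat_vec_linear_factor[OF A z(1)] by (simp add: h del: mult_pCons_left)
      then have "A *\<^sub>v ?w = a \<cdot>\<^sub>v ?w"
      proof (intro eq_vecI)
        fix i assume *: "A *\<^sub>v ?w - a \<cdot>\<^sub>v ?w = 0\<^sub>v n" and "i < dim_vec (a \<cdot>\<^sub>v ?w)"
        then have i: "i < n" using c[of h] by simp
        have "(A *\<^sub>v ?w - a \<cdot>\<^sub>v ?w) $ i = 0" using * i by simp
        then show "(A *\<^sub>v ?w) $ i = (a \<cdot>\<^sub>v ?w) $ i" using i c[of h] A by simp
      qed (use A c[of h] in simp)
      then show ?thesis using False c[of h] poly_mat_vec_in_subspace[OF A z(1) S] by blast
    qed
  qed
  then show ?thesis using exists_annihilating_poly[OF A z(1)] by blast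
qed

section \<open>Transfer between complex vectors and their real and imaginary parts\<close>

abbreviation re_vec :: "complex vec \<Rightarrow> real vec" where "re_vec \<equiv> map_vec Re"
abbreviation im_vec :: "complex vec \<Rightarrow> real vec" where "im_vec \<equiv> map_vec Im"

lemma re_im_cmat_mult_vec:
  assumes "A \<in> carrier_mat k l" "w \<in> carrier_vec l"
  shows "re_vec (cmat A *\<^sub>v w) = A *\<^sub>v re_vec w" "im_vec (cmat A *\<^sub>v w) = A *\<^sub>v im_vec w"
  using assms by (auto intro!: eq_vecI simp: scalar_prod_def)

lemma re_im_vec_eqI:
  assumes "re_vec u = re_vec w" "im_vec u = im_vec w"
  shows "u = w"
proof (rule eq_vecI)
  show d: "dim_vec u = dim_vec w" using assms(1) by (metis index_map_vec(2))
  fix i assume "i < dim_vec w"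
  then show "u $ i = w $ i" using assms d by (metis complex_eqI index_map_vec(1))
qed

lemma re_im_smult:
  "w \<in> carrier_vec n \<Longrightarrow> re_vec (c \<cdot>\<^sub>v w) = Re c \<cdot>\<^sub>v re_vec w - Im c \<cdot>\<^sub>v im_vec w"
  "w \<in> carrier_vec n \<Longrightarrow> im_vec (c \<cdot>\<^sub>v w) = Re c \<cdot>\<^sub>v im_vec w + Im c \<cdot>\<^sub>v re_vec w"
  by (auto intro!: eq_vecI)

lemma re_im_add:
  "u \<in> carrier_vec n \<Longrightarrow> w \<in> carrier_vec n \<Longrightarrow> re_vec (u + w) = re_vec u + re_vec w"
  "u \<in> carrier_vec n \<Longrightarrow> w \<in> carrier_vec n \<Longrightarrow> im_vec (u + w) = im_vec u + im_vec w"
  by (auto intro!: eq_vecI)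

lemma re_im_zero: "re_vec (0\<^sub>v n) = 0\<^sub>v n" "im_vec (0\<^sub>v n) = 0\<^sub>v n"
  by (auto intro!: eq_vecI)

lemma re_im_of_real: "re_vec (map_vec complex_of_real x) = x"
  "im_vec (map_vec complex_of_real x) = 0\<^sub>v (dim_vec x)"
  by (auto intro!: eq_vecI)

lemma scalar_prod_self_zero:
  fixes x :: "real vec"
  assumes "x \<in> carrier_vec n" "x \<bullet> x = 0"
  shows "x = 0\<^sub>v n"
proof (intro eq_vecI)
  fix i assume "i < dim_vec (0\<^sub>v n :: real vec)"
  moreover have "\<forall>i\<in>{0..<n}. x $ i * x $ i = 0"
    using assms by (subst sum_nonneg_eq_0_iff[symmetric]) (auto simp: scalar_prod_def)
  ultimately show "x $ i = 0\<^sub>v n $ i" by simp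
qed (use assms in auto)

lemma re_im_append:
  "re_vec (u @\<^sub>v w) = re_vec u @\<^sub>v re_vec w" "im_vec (u @\<^sub>v w) = im_vec u @\<^sub>v im_vec w"
  by (auto intro!: eq_vecI)

subsection \<open>Barbalat's lemma, subsequences and vector-valued derivatives\<close>

text \<open>On a window of fixed length \<open>d\<close>, a convergent \<open>f\<close> eventually
  changes by less than \<open>d * e / 2\<close>, so \<open>g\<close> is below \<open>e / 2\<close>
  in absolute value somewhere in the window. The bound on \<open>h\<close> then controls
  \<open>g\<close> on the whole window.\<close>

lemma barbalat:
  fixes f g h :: "real \<Rightarrow> real"
  assumes f: "\<And>t. t \<ge> 0 \<Longrightarrow> (f has_real_derivative g t) (at t within {0..})"
    and g: "\<And>t. t \<ge> 0 \<Longrightarrow> (g has_real_derivative h t) (at t within {0..})"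
    and h: "\<And>t. t \<ge> 0 \<Longrightarrow> \<bar>h t\<bar> \<le> C"
    and lim: "(f \<longlongrightarrow> l) at_top"
  shows "(g \<longlongrightarrow> 0) at_top"
proof (rule tendstoI)
  fix e :: real assume e: "e > 0"
  have C: "C \<ge> 0" using h[of 0] by simp
  \<comment> \<open>The window is so short that \<open>g\<close>, whose slope is at most
    \<open>C\<close>, changes by less than \<open>e / 2\<close> on it; the \<open>+ 1\<close> covers
    \<open>C = 0\<close>.\<close>
  define d where "d = e / (2 * (C + 1))"
  have d: "d > 0" using e C by (simp add: d_def)
  have Cd: "C * d < e / 2"
    using e C by (simp add: d_def field_simps)
  \<comment> \<open>Derivatives are given only within \<open>{0..}\<close>, hence one-sided at 0.
    The mean value theorem asks for two-sided derivatives in the open interval only, and continuity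
    at its ends.\<close>
  have mvt: "\<exists>z. t < z \<and> z < t + s \<and> u (t + s) - u t = s * u' z"
    if "t \<ge> 0" "s > 0" "\<And>t. t \<ge> 0 \<Longrightarrow> (u has_real_derivative u' t) (at t within {0..})" for t s u u'
  proof -
    have d: "DERIV u x :> u' x" if "x > t" for x
      using that(1) \<open>t \<ge> 0\<close> \<open>\<And>t. t \<ge> 0 \<Longrightarrow> (u has_real_derivative u' t) (at t within {0..})\<close>[of x]
        at_within_open_subset[of x "{0<..}" "{0..}"]
      by (simp add: subset_eq)
    have "continuous_on {t..t + s} u"
      using \<open>t \<ge> 0\<close> by (intro continuous_on_subset[OF DERIV_continuous_on[of "{0..}" u u']])
        (use that(3) in auto)
    then have "\<exists>l z. t < z \<and> z < t + s \<and> DERIV u z :> l \<and> u (t + s) - u t = (t + s - t) * l"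
      using d \<open>s > 0\<close> by (intro MVT) (auto simp: real_differentiable_def)
    then obtain l z where z: "t < z" "z < t + s" "DERIV u z :> l" "u (t + s) - u t = (t + s - t) * l"
      by blast
    then show ?thesis using DERIV_unique[OF z(3) d[OF z(1)]] by auto
  qed
  have "filterlim (\<lambda>t. t + d) at_top at_top"
    by (rule filterlim_at_top_mono[OF filterlim_ident]) (use d in \<open>auto intro!: always_eventually\<close>)
  then have "((\<lambda>t. f (t + d) - f t) \<longlongrightarrow> l - l) at_top"
    by (intro tendsto_diff lim filterlim_compose[OF lim])
  then have "\<forall>\<^sub>F t in at_top. \<bar>f (t + d) - f t\<bar> < d * (e / 2)"
    using tendstoD[of "\<lambda>t. f (t + d) - f t" 0 at_top "d * (e / 2)"] d e by (simp add: dist_real_def)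
  with eventually_ge_at_top[of 0] show "\<forall>\<^sub>F t in at_top. dist (g t) 0 < e"
  proof eventually_elim
    case (elim t)
    obtain z where z: "t < z" "z < t + d" "f (t + d) - f t = d * g z"
      using mvt[OF elim(1) d f] by auto
    have gz: "\<bar>g z\<bar> < e / 2" using elim(2) d by (simp add: z(3) abs_mult)
    obtain x where x: "t < x" "g z - g t = (z - t) * h x"
      using mvt[OF elim(1) _ g, of "z - t"] z(1) by auto
    have "\<bar>g z - g t\<bar> \<le> d * C"
      unfolding x(2) abs_mult by (rule mult_mono) (use h[of x] x(1) elim(1) z d in auto)
    then show ?case using gz Cd by (simp add: dist_real_def mult.commute)
  qed
qed

lemma nonincreasing_bounded_tendsto:
  fixes f :: "real \<Rightarrow> real"
  assumes mono: "\<And>s t. 0 \<le> s \<Longrightarrow> s \<le> t \<Longrightarrow> f t \<le> f s" and bound: "\<And>t. 0 \<le> t \<Longrightarrow> c \<le> f t"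
  shows "\<exists>l. (f \<longlongrightarrow> l) at_top"
proof (intro exI tendstoI)
  let ?l = "Inf (f ` {0..})"
  have bb: "bdd_below (f ` {0..})" using bound by (intro bdd_belowI[of _ c]) auto
  fix e :: real assume "e > 0"
  then obtain s where s: "s \<ge> 0" "f s < ?l + e"
    using cInf_lessD[of "f ` {0..}" "?l + e"] by auto
  show "\<forall>\<^sub>F t in at_top. dist (f t) ?l < e"
    using eventually_ge_at_top[of s]
  proof eventually_elim
    case (elim t)
    have "?l \<le> f t" by (rule cInf_lower[OF _ bb]) (use elim s in auto)
    then show ?case using mono[OF s(1) elim] s(2) by (simp add: dist_real_def)
  qed
qed

text \<open>Along the times \<open>(2 * pi * j + a) / \<omega>\<close> the function is constantly
  \<open>sin a\<close>, so a limit would equal both \<open>sin 0\<close> and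
  \<open>sin (pi / 2)\<close>.\<close>

lemma sin_not_convergent:
  assumes "\<omega> > 0"
  shows "\<not> ((\<lambda>t. sin (\<omega> * t)) \<longlongrightarrow> (l::real)) at_top"
proof
  assume l: "((\<lambda>t. sin (\<omega> * t)) \<longlongrightarrow> l) at_top"
  have lim: "filterlim (\<lambda>j. (2 * pi * real j + a) / \<omega>) at_top sequentially" for a
  proof -
    have "filterlim (\<lambda>j. a / \<omega> + (2 * pi / \<omega>) * real j) at_top sequentially"
      using assms by (intro filterlim_tendsto_add_at_top[OF tendsto_const]
          filterlim_tendsto_pos_mult_at_top[OF tendsto_const] filterlim_real_sequentially) auto
    then show ?thesis using assms by (simp add: field_simps)
  qed
  have per: "sin (2 * pi * real j + a) = sin a" for j a
    using sin_2npi[of j] cos_2npi[of j] by (simp add: sin_add mult_ac)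
  have "sin a = l" for a
  proof -
    have "(\<lambda>j::nat. sin a) \<longlonglongrightarrow> l"
      using filterlim_compose[OF l lim[of a]] assms by (simp add: per)
    then show ?thesis by (simp add: LIMSEQ_const_iff)
  qed
  from this[of 0] this[of "pi / 2"] show False by simp
qed

text \<open>Bolzano-Weierstrass for finitely many coordinates: a subsequence that works for the
  earlier coordinates is thinned to one that is monotone in the next coordinate; bounded and
  monotone, it converges, and thinning keeps the earlier limits.\<close>

lemma bounded_family_convergent_subseq:
  fixes f :: "nat \<Rightarrow> nat \<Rightarrow> real"
  assumes "\<And>i. i < n \<Longrightarrow> \<exists>C. \<forall>j. \<bar>f j i\<bar> \<le> C"
  shows "\<exists>\<rho> l. strict_mono \<rho> \<and> (\<forall>i<n. (\<lambda>j. f (\<rho> j) i) \<longlonglongrightarrow> l i)"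
  using assms
proof (induction n)
  case 0
  show ?case by (rule exI[of _ id]) (auto simp: strict_mono_def)
next
  case (Suc n)
  then obtain \<rho> l where \<rho>: "strict_mono \<rho>" "\<And>i. i < n \<Longrightarrow> (\<lambda>j. f (\<rho> j) i) \<longlonglongrightarrow> l i"
    by (metis less_SucI)
  obtain s where s: "strict_mono s" "monoseq (\<lambda>j. f (\<rho> (s j)) n)"
    using seq_monosub[of "\<lambda>j. f (\<rho> j) n"] by auto
  obtain C where "\<forall>j. \<bar>f j n\<bar> \<le> C" using Suc.prems by blast
  then have "Bseq (\<lambda>j. f (\<rho> (s j)) n)" by (intro BseqI'[of _ C]) auto
  then obtain l' where l': "(\<lambda>j. f (\<rho> (s j)) n) \<longlonglongrightarrow> l'"
    using Bseq_monoseq_convergent[OF _ s(2)] by (auto simp: convergent_def)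
  have "(\<lambda>j. f ((\<rho> \<circ> s) j) i) \<longlonglongrightarrow> (l(n := l')) i" if "i < Suc n" for i
    using that l' LIMSEQ_subseq_LIMSEQ[OF \<rho>(2) s(1), of i]
    by (cases "i = n") (auto simp: o_def)
  then show ?case using strict_mono_o[OF \<rho>(1) s(1)] by blast
qed

lemma has_deriv_vec_scalar_prod:
  assumes "has_deriv_vec u u' (at t within S)" "has_deriv_vec w w' (at t within S)" "t \<in> S"
    and "\<And>s. s \<in> S \<Longrightarrow> u s \<in> carrier_vec n" "\<And>s. s \<in> S \<Longrightarrow> w s \<in> carrier_vec n"
    and "u' \<in> carrier_vec n" "w' \<in> carrier_vec n"
  shows "((\<lambda>s. u s \<bullet> w s) has_real_derivative u' \<bullet> w t + u t \<bullet> w') (at t within S)"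
proof -
  have D1: "((\<lambda>s. \<Sum>i<n. u s $ i * w s $ i) has_real_derivative
      (\<Sum>i<n. u' $ i * w t $ i + u t $ i * w' $ i)) (at t within S)"
  proof (rule DERIV_sum)
    fix i assume "i \<in> {..<n}"
    then have "((\<lambda>s. u s $ i) has_real_derivative u' $ i) (at t within S)"
      "((\<lambda>s. w s $ i) has_real_derivative w' $ i) (at t within S)"
      using assms by (auto simp: has_deriv_vec_def)
    from DERIV_mult'[OF this]
    show "((\<lambda>s. u s $ i * w s $ i) has_real_derivative u' $ i * w t $ i + u t $ i * w' $ i) (at t within S)"
      by (simp add: add.commute)
  qed
  have D2: "(\<Sum>i<n. u' $ i * w t $ i + u t $ i * w' $ i) = u' \<bullet> w t + u t \<bullet> w'"
    using assms(5)[OF assms(3)] assms(7) by (simp add: scalar_prod_def sum.distrib atLeast0LessThan)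
  \<comment> \<open>The length \<open>n\<close> of the vectors is known only for times in
    \<open>S\<close>, so the scalar product agrees with the finite sum only there; the derivative is
    therefore transferred within \<open>S\<close>.\<close>
  have e: "u s \<bullet> w s = (\<Sum>i<n. u s $ i * w s $ i)" if "s \<in> S" for s
    using assms(5)[OF that] by (auto simp: scalar_prod_def atLeast0LessThan)
  from D1 D2 have "((\<lambda>s. \<Sum>i<n. u s $ i * w s $ i) has_derivative (*) (u' \<bullet> w t + u t \<bullet> w')) (at t within S)"
    by (simp add: has_field_derivative_def)
  then show ?thesis
    unfolding has_field_derivative_def by (rule has_derivative_transform[OF assms(3) e, rotated])
qed

lemma has_deriv_vec_const: "has_deriv_vec (\<lambda>_. u) (0\<^sub>v n) F"
  by (auto simp: has_deriv_vec_def)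

lemma has_deriv_vec_scalar_prod_const:
  assumes "has_deriv_vec w w' (at t within S)" "t \<in> S"
    and "\<And>s. s \<in> S \<Longrightarrow> w s \<in> carrier_vec n" "u \<in> carrier_vec n" "w' \<in> carrier_vec n"
  shows "((\<lambda>s. u \<bullet> w s) has_real_derivative u \<bullet> w') (at t within S)"
  using has_deriv_vec_scalar_prod[OF has_deriv_vec_const[of u n] assms(1,2), of n] assms by auto

lemma has_deriv_vec_mult_mat:
  assumes "has_deriv_vec w w' (at t within S)" "t \<in> S"
    and "\<And>s. s \<in> S \<Longrightarrow> w s \<in> carrier_vec n" "A \<in> carrier_mat k n" "w' \<in> carrier_vec n"
  shows "has_deriv_vec (\<lambda>s. A *\<^sub>v w s) (A *\<^sub>v w') (at t within S)"
  using assms has_deriv_vec_scalar_prod_const[OF assms(1-3) row_carrier_vec[of _ k A n] assms(5)]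
  by (auto simp: has_deriv_vec_def)

subsection \<open>Positive (semi)definite and block matrices\<close>

text \<open>The form at \<open>x + s y\<close> is a nonnegative quadratic polynomial in
  \<open>s\<close>. For positive leading coefficient its value at the minimiser
  \<open>- ?b / ?c\<close> gives the claim.\<close>

lemma pos_semidef_cauchy_schwarz:
  assumes A: "pos_semidef_mat k A" and x: "x \<in> carrier_vec k" and y: "y \<in> carrier_vec k"
  shows "(x \<bullet> (A *\<^sub>v y))\<^sup>2 \<le> (x \<bullet> (A *\<^sub>v x)) * (y \<bullet> (A *\<^sub>v y))"
proof -
  let ?a = "x \<bullet> (A *\<^sub>v x)" and ?b = "x \<bullet> (A *\<^sub>v y)" and ?c = "y \<bullet> (A *\<^sub>v y)"
  have Ac: "A \<in> carrier_mat k k" and AT: "A\<^sup>T = A"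
    and pos: "\<And>x. x \<in> carrier_vec k \<Longrightarrow> 0 \<le> x \<bullet> (A *\<^sub>v x)"
    using A by (auto simp: pos_semidef_mat_def)
  have yx: "y \<bullet> (A *\<^sub>v x) = ?b"
    using transpose_vec_mult_scalar[OF Ac x y] AT comm_scalar_prod[of "A *\<^sub>v y" k x] Ac x y by simp
  have q: "0 \<le> ?a + 2 * s * ?b + s\<^sup>2 * ?c" for s
  proof -
    have e: "A *\<^sub>v (x + s \<cdot>\<^sub>v y) = A *\<^sub>v x + s \<cdot>\<^sub>v (A *\<^sub>v y)"
      using mult_add_distrib_mat_vec[OF Ac x, of "s \<cdot>\<^sub>v y"] mult_mat_vec[OF Ac y] y by simp
    have "(x + s \<cdot>\<^sub>v y) \<bullet> (A *\<^sub>v (x + s \<cdot>\<^sub>v y)) = ?a + s * ?b + (s * (y \<bullet> (A *\<^sub>v x)) + s * (s * ?c))"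
      unfolding e using Ac x y
      by (subst add_scalar_prod_distrib[of _ k], simp, simp, simp)
         (simp add: scalar_prod_add_distrib[of _ k])
    then show ?thesis using pos[of "x + s \<cdot>\<^sub>v y"] x y yx by (simp add: power2_eq_square algebra_simps)
  qed
  show ?thesis
  proof (cases "?c = 0")
    case True
    \<comment> \<open>With \<open>?c = 0\<close> the polynomial is affine in \<open>s\<close>; if
      \<open>?b\<close> were nonzero, this \<open>s\<close> would give it the value
      \<open>-1\<close>.\<close>
    then show ?thesis using q[of "- (?a + 1) / (2 * ?b)"]
      by (cases "?b = 0") (auto simp: field_simps)
  next
    case False
    then have c: "?c > 0" using pos[OF y] by simp
    have "0 \<le> ?a - ?b\<^sup>2 / ?c" using q[of "- ?b / ?c"] c by (simp add: power2_eq_square field_simps)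
    then show ?thesis using c by (simp add: field_simps)
  qed
qed

lemma pos_def_imp_semidef: "pos_def_mat k A \<Longrightarrow> pos_semidef_mat k A"
  unfolding pos_def_mat_def pos_semidef_mat_def
  by (metis carrier_matD(1) dim_mult_mat_vec carrier_vecI less_eq_real_def scalar_prod_left_zero)

lemma pos_def_inj:
  assumes "pos_def_mat k A" "x \<in> carrier_vec k" "A *\<^sub>v x = 0\<^sub>v k"
  shows "x = 0\<^sub>v k"
  using assms unfolding pos_def_mat_def by (metis less_irrefl scalar_prod_right_zero)

text \<open>Cauchy-Schwarz against the unit vectors bounds the square of every entry of
  \<open>A x\<close> by a multiple of \<open>x . A x\<close>, which is zero.\<close>

lemma pos_semidef_kernel:
  assumes A: "pos_semidef_mat k A" and x: "x \<in> carrier_vec k" and "x \<bullet> (A *\<^sub>v x) = 0"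
  shows "A *\<^sub>v x = 0\<^sub>v k"
proof (intro eq_vecI)
  have Ac: "A \<in> carrier_mat k k" using A by (auto simp: pos_semidef_mat_def)
  fix i assume "i < dim_vec (0\<^sub>v k :: real vec)"
  then have i: "i < k" by simp
  have "(unit_vec k i \<bullet> (A *\<^sub>v x))\<^sup>2 \<le> 0"
    using pos_semidef_cauchy_schwarz[OF A _ x, of "unit_vec k i"] assms(3) by simp
  then show "(A *\<^sub>v x) $ i = 0\<^sub>v k $ i" using i Ac x
    by (simp add: scalar_prod_left_unit[of _ k])
qed (use A in \<open>auto simp: pos_semidef_mat_def\<close>)

lemma mult_mat_vec_scalar_prod:
  fixes A :: "'a::comm_semiring_0 mat"
  assumes "A \<in> carrier_mat k l" "x \<in> carrier_vec k" "y \<in> carrier_vec l"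
  shows "x \<bullet> (A *\<^sub>v y) = (A\<^sup>T *\<^sub>v x) \<bullet> y"
  using transpose_vec_mult_scalar[OF assms(1,3,2)] assms
    comm_scalar_prod[of x k "A *\<^sub>v y"] comm_scalar_prod[of "A\<^sup>T *\<^sub>v x" l y] by simp

section \<open>Block-diagonal matrices and definiteness\<close>

abbreviation block_diag2 :: "'a::zero mat \<Rightarrow> 'a mat \<Rightarrow> 'a mat" where
  "block_diag2 A D \<equiv> four_block_mat A (0\<^sub>m (dim_row A) (dim_col D)) (0\<^sub>m (dim_row D) (dim_col A)) D"

lemma block_diag2_mult_vec:
  fixes A D :: "real mat"
  assumes "A \<in> carrier_mat k k" "D \<in> carrier_mat l l" "x \<in> carrier_vec k" "y \<in> carrier_vec l"
  shows "block_diag2 A D *\<^sub>v (x @\<^sub>v y) = (A *\<^sub>v x) @\<^sub>v (D *\<^sub>v y)"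
proof -
  have "A *\<^sub>v x \<in> carrier_vec k" "D *\<^sub>v y \<in> carrier_vec l"
    using assms by (auto intro: mult_mat_vec_carrier)
  then show ?thesis
    using assms by (subst four_block_mat_mult_vec[of _ k k _ l _ l]) (auto simp: carrier_vecD)
qed

lemma block_diag2_quadratic_form:
  fixes A D :: "real mat"
  assumes "A \<in> carrier_mat k k" "D \<in> carrier_mat l l" "x \<in> carrier_vec k" "y \<in> carrier_vec l"
  shows "(x @\<^sub>v y) \<bullet> (block_diag2 A D *\<^sub>v (x @\<^sub>v y)) = x \<bullet> (A *\<^sub>v x) + y \<bullet> (D *\<^sub>v y)"
  unfolding block_diag2_mult_vec[OF assms]
  using assms by (intro scalar_prod_append[of _ k _ l] mult_mat_vec_carrier)

lemma block_diag2_transpose: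
  assumes "A \<in> carrier_mat k k" "D \<in> carrier_mat l l" "A\<^sup>T = A" "D\<^sup>T = D"
  shows "(block_diag2 A D)\<^sup>T = block_diag2 A D"
  using assms transpose_four_block_mat[of A k k "0\<^sub>m k l" l "0\<^sub>m l k" l D] by auto

lemma carrier_vec_split:
  assumes "x \<in> carrier_vec (k + l)"
  obtains a b where "x = a @\<^sub>v b" "a \<in> carrier_vec k" "b \<in> carrier_vec l"
  using assms vec_first_last_append[of x k l] vec_first_carrier vec_last_carrier by metis

lemma append_zero_vec: "0\<^sub>v k @\<^sub>v 0\<^sub>v l = 0\<^sub>v (k + l)"
  by (intro eq_vecI) auto

lemma pos_semidef_block_diag2:
  assumes A: "pos_semidef_mat k A" and D: "pos_semidef_mat l D"
  shows "pos_semidef_mat (k + l) (block_diag2 A D)"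
proof -
  have c: "A \<in> carrier_mat k k" "D \<in> carrier_mat l l" "A\<^sup>T = A" "D\<^sup>T = D"
    using A D by (auto simp: pos_semidef_mat_def)
  have "0 \<le> x \<bullet> (block_diag2 A D *\<^sub>v x)" if x: "x \<in> carrier_vec (k + l)" for x
  proof -
    obtain a b where ab: "x = a @\<^sub>v b" "a \<in> carrier_vec k" "b \<in> carrier_vec l"
      using carrier_vec_split[OF x] by blast
    show ?thesis
      unfolding ab(1) block_diag2_quadratic_form[OF c(1,2) ab(2,3)]
      using A D ab by (simp add: pos_semidef_mat_def)
  qed
  then show ?thesis
    using block_diag2_transpose[OF c] four_block_carrier_mat[OF c(1,2)]
    by (simp add: pos_semidef_mat_def)
qed

lemma pos_def_block_diag2:
  assumes A: "pos_def_mat k A" and D: "pos_def_mat l D"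
  shows "pos_def_mat (k + l) (block_diag2 A D)"
proof -
  have c: "A \<in> carrier_mat k k" "D \<in> carrier_mat l l" "A\<^sup>T = A" "D\<^sup>T = D"
    using A D by (auto simp: pos_def_mat_def)
  have "0 < x \<bullet> (block_diag2 A D *\<^sub>v x)" if x: "x \<in> carrier_vec (k + l)" and x0: "x \<noteq> 0\<^sub>v (k + l)" for x
  proof -
    obtain a b where ab: "x = a @\<^sub>v b" "a \<in> carrier_vec k" "b \<in> carrier_vec l"
      using carrier_vec_split[OF x] by blast
    have "a \<noteq> 0\<^sub>v k \<or> b \<noteq> 0\<^sub>v l" using x0 ab by (auto simp: append_zero_vec)
    moreover have "a \<noteq> 0\<^sub>v k \<Longrightarrow> 0 < a \<bullet> (A *\<^sub>v a)" "b \<noteq> 0\<^sub>v l \<Longrightarrow> 0 < b \<bullet> (D *\<^sub>v b)"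
      using A D ab by (auto simp: pos_def_mat_def)
    moreover have "0 \<le> a \<bullet> (A *\<^sub>v a)" "0 \<le> b \<bullet> (D *\<^sub>v b)"
      using pos_def_imp_semidef[OF A] pos_def_imp_semidef[OF D] ab by (auto simp: pos_semidef_mat_def)
    ultimately show ?thesis
      unfolding ab(1) block_diag2_quadratic_form[OF c(1,2) ab(2,3)] by linarith
  qed
  then show ?thesis
    using block_diag2_transpose[OF c] four_block_carrier_mat[OF c(1,2)]
    by (simp add: pos_def_mat_def)
qed

text \<open>The empty list gives the 0 by 0 matrix, which is vacuously definite. This case arises
  for \<open>Mu\<close> when every node is damped and for \<open>W\<close> when the graph has no
  edge.\<close>

lemma pos_def_diag_block_mat:
  "\<forall>A\<in>set As. pos_def_mat r A \<Longrightarrow> pos_def_mat (length As * r) (diag_block_mat As)"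
proof (induction As)
  case Nil
  show ?case by (auto simp: pos_def_mat_def intro!: eq_matI)
next
  case (Cons A As)
  then show ?case using pos_def_block_diag2[of r A "length As * r" "diag_block_mat As"] by (simp add: Let_def)
qed

lemma pos_semidef_diag_block_mat:
  "\<forall>A\<in>set As. pos_semidef_mat r A \<Longrightarrow> pos_semidef_mat (length As * r) (diag_block_mat As)"
proof (induction As)
  case Nil
  show ?case by (auto simp: pos_semidef_mat_def scalar_prod_def intro!: eq_matI)
next
  case (Cons A As)
  then show ?case using pos_semidef_block_diag2[of r A "length As * r" "diag_block_mat As"] by (simp add: Let_def)
qed

lemma transpose_append_rows_mult_vec:
  fixes A B :: "'a::comm_semiring_0 mat"
  assumes "A \<in> carrier_mat k n" "B \<in> carrier_mat l n" "x \<in> carrier_vec k" "y \<in> carrier_vec l"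
  shows "(A @\<^sub>r B)\<^sup>T *\<^sub>v (x @\<^sub>v y) = A\<^sup>T *\<^sub>v x + B\<^sup>T *\<^sub>v y"
proof (intro eq_vecI)
  have AB: "A @\<^sub>r B \<in> carrier_mat (k + l) n" using assms by auto
  fix i assume "i < dim_vec (A\<^sup>T *\<^sub>v x + B\<^sup>T *\<^sub>v y)"
  then have i: "i < n" using assms by simp
  have "col (A @\<^sub>r B) i = col A i @\<^sub>v col B i"
    unfolding append_rows_def using assms i by (intro col_four_block_mat[of _ k _ _ 0 _ l]) auto
  then show "((A @\<^sub>r B)\<^sup>T *\<^sub>v (x @\<^sub>v y)) $ i = (A\<^sup>T *\<^sub>v x + B\<^sup>T *\<^sub>v y) $ i"
    using carrier_matD[OF AB] assms i scalar_prod_append[of "col A i" k "col B i" l x y] by simp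
qed (use assms in \<open>simp add: append_rows_def\<close>)

lemma cmat_append_rows_mult_vec:
  assumes A: "A \<in> carrier_mat k n" and B: "B \<in> carrier_mat l n" and w: "w \<in> carrier_vec n"
  shows "cmat (A @\<^sub>r B) *\<^sub>v w = (cmat A *\<^sub>v w) @\<^sub>v (cmat B *\<^sub>v w)"
proof -
  have "cmat (A @\<^sub>r B) = cmat A @\<^sub>r cmat B"
    using A B by (intro eq_matI) (auto simp: append_rows_def)
  then show ?thesis using mat_mult_append[of "cmat A" k n "cmat B" l w] assms by simp
qed

text \<open>The dimensions of \<open>A\<close> and \<open>B\<close> need not match: in the reduced system \<open>A\<close> involves
  \<^const>\<open>minv\<close> of a matrix that is singular if all nodes are damped.\<close>

lemma mult_mat_vec_eq_0:
  assumes "w \<in> carrier_vec (dim_col B)" "B *\<^sub>v w = 0\<^sub>v (dim_row B)"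
  shows "(A * B) *\<^sub>v w = 0\<^sub>v (dim_row A)"
proof (intro eq_vecI)
  fix i assume "i < dim_vec (0\<^sub>v (dim_row A))"
  then have i: "i < dim_row A" by simp
  have "((A * B) *\<^sub>v w) $ i = (\<Sum>j<dim_col B. (\<Sum>k<dim_row B. row A i $ k * B $$ (k, j)) * w $ j)"
    using i assms(1) by (simp add: scalar_prod_def atLeast0LessThan)
  also have "\<dots> = (\<Sum>k<dim_row B. row A i $ k * (\<Sum>j<dim_col B. B $$ (k, j) * w $ j))"
    unfolding sum_distrib_left sum_distrib_right mult.assoc by (rule sum.swap)
  also have "\<dots> = (\<Sum>k<dim_row B. row A i $ k * (B *\<^sub>v w) $ k)"
    using assms(1) by (intro sum.cong refl) (auto simp: scalar_prod_def atLeast0LessThan)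
  also have "\<dots> = 0" using assms(2) by simp
  finally show "((A * B) *\<^sub>v w) $ i = 0\<^sub>v (dim_row A) $ i" using i by simp
qed simp

lemma mat_kernel_shift:
  fixes X :: "'a::comm_ring_1 mat"
  assumes X: "X \<in> carrier_mat k k"
  shows "mat_kernel (X - \<mu> \<cdot>\<^sub>m 1\<^sub>m k) = {w \<in> carrier_vec k. X *\<^sub>v w = \<mu> \<cdot>\<^sub>v w}"
proof -
  have "(X - \<mu> \<cdot>\<^sub>m 1\<^sub>m k) *\<^sub>v w = 0\<^sub>v k \<longleftrightarrow> X *\<^sub>v w = \<mu> \<cdot>\<^sub>v w" if w: "w \<in> carrier_vec k" for w
  proof -
    have "(\<mu> \<cdot>\<^sub>m 1\<^sub>m k) *\<^sub>v w = \<mu> \<cdot>\<^sub>v w"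
      using w by (intro eq_vecI) auto
    then have e: "(X - \<mu> \<cdot>\<^sub>m 1\<^sub>m k) *\<^sub>v w = X *\<^sub>v w - \<mu> \<cdot>\<^sub>v w"
      using minus_mult_distrib_mat_vec[OF X _ w, of "\<mu> \<cdot>\<^sub>m 1\<^sub>m k"] by simp
    show ?thesis
    proof
      assume "(X - \<mu> \<cdot>\<^sub>m 1\<^sub>m k) *\<^sub>v w = 0\<^sub>v k"
      then have *: "X *\<^sub>v w - \<mu> \<cdot>\<^sub>v w = 0\<^sub>v k" by (simp add: e)
      show "X *\<^sub>v w = \<mu> \<cdot>\<^sub>v w"
      proof (intro eq_vecI)
        fix i assume "i < dim_vec (\<mu> \<cdot>\<^sub>v w)"
        then have i: "i < k" using w by simp
        have "(X *\<^sub>v w - \<mu> \<cdot>\<^sub>v w) $ i = 0" using * i by simp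
        then show "(X *\<^sub>v w) $ i = (\<mu> \<cdot>\<^sub>v w) $ i" using i w X by simp
      qed (use X w in simp)
    next
      assume "X *\<^sub>v w = \<mu> \<cdot>\<^sub>v w"
      then show "(X - \<mu> \<cdot>\<^sub>m 1\<^sub>m k) *\<^sub>v w = 0\<^sub>v k" unfolding e using w by (intro eq_vecI) auto
    qed
  qed
  then show ?thesis using X by (auto simp: mat_kernel_def)
qed

text \<open>A nonzero \<open>w\<close> with \<open>X w = \<mu> w\<close> itself certifies that
  \<open>\<mu>\<close> lies in the spectrum, so \<open>\<mu>\<close> may range over all complex
  numbers. Having zero in \<open>Q\<close> makes the intersection equal to, not merely contained in,
  the zero space. Conditions (ii) and (iii) both have this shape, for different
  \<open>Q\<close>.\<close>

lemma no_eigenvector_in_iff: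
  fixes X :: "complex mat"
  assumes X: "X \<in> carrier_mat k k" and Q: "0\<^sub>v k \<in> Q"
  shows "(\<forall>\<mu>\<in>spectrum X. mat_kernel (X - \<mu> \<cdot>\<^sub>m 1\<^sub>m k) \<inter> Q = {0\<^sub>v k}) \<longleftrightarrow>
    (\<forall>\<mu> w. w \<in> carrier_vec k \<longrightarrow> X *\<^sub>v w = \<mu> \<cdot>\<^sub>v w \<longrightarrow> w \<in> Q \<longrightarrow> w = 0\<^sub>v k)"
    (is "?l \<longleftrightarrow> ?r")
proof
  assume l: ?l
  show ?r
  proof (intro allI impI, rule ccontr)
    fix \<mu> w assume w: "w \<in> carrier_vec k" "X *\<^sub>v w = \<mu> \<cdot>\<^sub>v w" "w \<in> Q" "w \<noteq> 0\<^sub>v k"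
    then have "\<mu> \<in> spectrum X"
      using X by (auto simp: spectrum_def eigenvalue_def eigenvector_def)
    then have "w \<in> {0\<^sub>v k}" using l w unfolding mat_kernel_shift[OF X] by blast
    then show False using w by simp
  qed
next
  assume r: ?r
  have "X *\<^sub>v 0\<^sub>v k = \<mu> \<cdot>\<^sub>v 0\<^sub>v k" for \<mu> using X by (intro eq_vecI) auto
  then show ?l unfolding mat_kernel_shift[OF X] using r Q by auto
qed

subsection \<open>The kernel of the incidence matrix\<close>

lemma ones_kronecker_mult_vec:
  fixes u :: "real vec"
  assumes u: "u \<in> carrier_vec r" and j: "j < n * r"
  shows "((mat n 1 (\<lambda>_. 1) \<otimes>\<^sub>K 1\<^sub>m r) *\<^sub>v u) $ j = u $ (j mod r)"
proof -
  have r: "j mod r < r" and n: "j div r < n" using j by (cases "r = 0"; auto simp: less_mult_imp_div_less)+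
  have "((mat n 1 (\<lambda>_. 1) \<otimes>\<^sub>K 1\<^sub>m r) *\<^sub>v u) $ j = (\<Sum>b<r. (if j mod r = b then 1 else 0) * u $ b)"
    using u j r n by (auto simp: kronecker_mat_def scalar_prod_def atLeast0LessThan intro!: sum.cong)
  also have "\<dots> = u $ (j mod r)" using r by (simp add: if_distrib[of "\<lambda>x. x * _"] cong: if_cong)
  finally show ?thesis .
qed

text \<open>Index \<open>k * r + a\<close> encodes coordinate \<open>a\<close> of edge
  \<open>k\<close>, and likewise for nodes. The corresponding column of the Kronecker product has
  only the two nonzero entries that belong to coordinate \<open>a\<close> of the endpoints.\<close>

lemma kronecker_id_transpose_mult_vec:
  fixes B :: "real mat" and x :: "real vec"
  assumes B: "B \<in> carrier_mat n m" and x: "x \<in> carrier_vec (n * r)" and k: "k < m" and a: "a < r"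
    and ij: "i < n" "j < n" "i \<noteq> j" "B $$ (i, k) = 1" "B $$ (j, k) = -1"
    and rest: "\<And>l. l < n \<Longrightarrow> l \<noteq> i \<Longrightarrow> l \<noteq> j \<Longrightarrow> B $$ (l, k) = 0"
  shows "((B \<otimes>\<^sub>K 1\<^sub>m r)\<^sup>T *\<^sub>v x) $ (k * r + a) = x $ (i * r + a) - x $ (j * r + a)"
proof -
  have lt: "l * r + a < n' * r" if "l < n'" for l n'
  proof -
    have "l * r + a < Suc l * r" using a by simp
    also have "\<dots> \<le> n' * r" using that by (intro mult_le_mono1) simp
    finally show ?thesis .
  qed
  let ?f = "\<lambda>l. B $$ (l div r, k) * (if l mod r = a then 1 else 0) * x $ l"
  have "((B \<otimes>\<^sub>K 1\<^sub>m r)\<^sup>T *\<^sub>v x) $ (k * r + a) = (\<Sum>l<n * r. ?f l)"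
    using B x a lt[OF k]
    by (auto simp: kronecker_mat_def scalar_prod_def atLeast0LessThan intro!: sum.cong)
  also have "\<dots> = (\<Sum>l\<in>{i * r + a, j * r + a}. ?f l)"
  proof (rule sum.mono_neutral_right)
    show "{i * r + a, j * r + a} \<subseteq> {..<n * r}" using lt ij by auto
    show "\<forall>l\<in>{..<n * r} - {i * r + a, j * r + a}. ?f l = 0"
    proof
      fix l assume l: "l \<in> {..<n * r} - {i * r + a, j * r + a}"
      show "?f l = 0"
      proof (cases "l mod r = a")
        case True
        then have "l = (l div r) * r + a" by (metis div_mult_mod_eq)
        then have "l div r \<noteq> i" "l div r \<noteq> j" using l by auto
        moreover have "l div r < n" using l by (simp add: less_mult_imp_div_less)
        ultimately show ?thesis using rest by simp
      qed simp
    qed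
  qed simp
  also have "\<dots> = x $ (i * r + a) - x $ (j * r + a)"
    using a ij by simp
  finally show ?thesis .
qed

lemma connected_graph_const:
  assumes "connected_graph V E" "\<And>i j. {i, j} \<in> E \<Longrightarrow> f i = f j" "u \<in> V" "w \<in> V"
  shows "f u = f w"
proof -
  have "(u, w) \<in> {(a, b). {a, b} \<in> E}\<^sup>*" using assms by (auto simp: connected_graph_def)
  then show ?thesis by (induction rule: rtrancl_induct) (use assms(2) in auto)
qed

text \<open>The transposed incidence matrix takes differences across edges. If they all vanish, each
  coordinate is constant along paths, and connectedness spreads the value at node 0 to all nodes.
  The converse is cancellation of equal entries.\<close>

lemma incidence_kernel_iff:
  fixes B :: "real mat"
  assumes graph: "connected_graph {..<n} (set es)" and inc: "oriented_incidence_mat n es B"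
    and x: "x \<in> carrier_vec (n * r)"
  shows "(B \<otimes>\<^sub>K 1\<^sub>m r)\<^sup>T *\<^sub>v x = 0\<^sub>v (length es * r)
    \<longleftrightarrow> x \<in> mat_image (mat n 1 (\<lambda>_. 1) \<otimes>\<^sub>K 1\<^sub>m r)"
proof -
  have B: "B \<in> carrier_mat n (length es)" using inc by (simp add: oriented_incidence_mat_def)
  have n: "n > 0" using graph by (auto simp: connected_graph_def)
  let ?X = "(B \<otimes>\<^sub>K 1\<^sub>m r)\<^sup>T *\<^sub>v x" and ?I = "mat n 1 (\<lambda>_. 1) \<otimes>\<^sub>K 1\<^sub>m r :: real mat"
  have dimX: "dim_vec ?X = length es * r" using B by (simp add: kronecker_mat_def)
  have dimI: "dim_row ?I = n * r" "dim_col ?I = r" by (auto simp: kronecker_mat_def)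
  have edge: "\<exists>i j. es ! k = {i, j} \<and> i < n \<and> j < n \<and>
      (\<forall>a<r. ?X $ (k * r + a) = x $ (i * r + a) - x $ (j * r + a))" if k: "k < length es" for k
  proof -
    obtain i j where ij: "i \<noteq> j" "es ! k = {i, j}" "B $$ (i, k) = 1" "B $$ (j, k) = -1"
      "\<forall>l<n. l \<noteq> i \<and> l \<noteq> j \<longrightarrow> B $$ (l, k) = 0"
      using inc k unfolding oriented_incidence_mat_def by blast
    have "{i, j} \<subseteq> {..<n}" using graph k ij(2) nth_mem[OF k] unfolding connected_graph_def by metis
    then have "i < n" "j < n" by auto
    then show ?thesis using kronecker_id_transpose_mult_vec[OF B x k] ij by metis
  qed
  have lt: "l * r + a < n' * r" if "l < n'" "a < r" for l n' a :: nat
  proof -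
    have "l * r + a < Suc l * r" using that by simp
    also have "\<dots> \<le> n' * r" using that by (intro mult_le_mono1) simp
    finally show ?thesis .
  qed
  show ?thesis
  proof
    assume X0: "?X = 0\<^sub>v (length es * r)"
    have const: "x $ (i * r + a) = x $ (0 * r + a)" if a: "a < r" and i: "i < n" for i a
    proof (rule connected_graph_const[OF graph, where f = "\<lambda>i. x $ (i * r + a)"])
      fix i' j' assume "{i', j'} \<in> set es"
      then obtain k where k: "k < length es" "es ! k = {i', j'}" by (metis in_set_conv_nth)
      obtain i j where "es ! k = {i, j}" "?X $ (k * r + a) = x $ (i * r + a) - x $ (j * r + a)"
        using edge[OF k(1)] a by blast
      moreover have "?X $ (k * r + a) = 0" unfolding X0 using lt[OF k(1) a] by simp
      ultimately show "x $ (i' * r + a) = x $ (j' * r + a)"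
        using k(2) by (auto simp: doubleton_eq_iff)
    qed (use i n in auto)
    have "x = ?I *\<^sub>v vec r (\<lambda>a. x $ a)"
    proof (intro eq_vecI)
      fix j assume "j < dim_vec (?I *\<^sub>v vec r (\<lambda>a. x $ a))"
      then have j: "j < n * r" using dimI by simp
      have r: "j mod r < r" and jn: "j div r < n"
        using j by (cases "r = 0"; auto simp: less_mult_imp_div_less)+
      have "x $ j = x $ (j mod r)" using const[OF r jn] by simp
      then show "x $ j = (?I *\<^sub>v vec r (\<lambda>a. x $ a)) $ j"
        using r ones_kronecker_mult_vec[OF _ j, of "vec r (\<lambda>a. x $ a)"] by simp
    qed (use x dimI in simp)
    then show "x \<in> mat_image ?I" unfolding mat_image_def dimI by (intro image_eqI) auto
  next
    assume "x \<in> mat_image ?I"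
    then obtain u where u: "u \<in> carrier_vec r" "x = ?I *\<^sub>v u"
      unfolding mat_image_def dimI by blast
    show "?X = 0\<^sub>v (length es * r)"
    proof (intro eq_vecI)
      fix c assume "c < dim_vec (0\<^sub>v (length es * r) :: real vec)"
      then have c: "c < length es * r" by simp
      have a: "c mod r < r" and k: "c div r < length es"
        using c by (cases "r = 0"; auto simp: less_mult_imp_div_less)+
      obtain i j where ij: "i < n" "j < n"
        "?X $ (c div r * r + c mod r) = x $ (i * r + c mod r) - x $ (j * r + c mod r)"
        using edge[OF k] a by blast
      have "x $ (l * r + c mod r) = u $ (c mod r)" if "l < n" for l
        unfolding u(2) using ones_kronecker_mult_vec[OF u(1) lt[OF that a]] a by simp
      then show "?X $ c = 0\<^sub>v (length es * r) $ c" using ij c by simp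
    qed (simp only: dimX index_zero_vec)
  qed
qed

subsection \<open>Energy dissipation and convergence of the output\<close>

text \<open>The Popov-Belevitch-Hautus eigenvector test for observability of the pair
  \<open>(A, C)\<close>. It is used with \<open>A = M\<^sup>-\<^sup>1 L\<close> and
  \<open>C = R\<close>, which is why \<open>C\<close> has \<open>n\<close> rows.\<close>

definition unobservable_mode_free :: "nat \<Rightarrow> real mat \<Rightarrow> real mat \<Rightarrow> bool" where
  "unobservable_mode_free n A C \<longleftrightarrow> (\<forall>\<mu> w. w \<in> carrier_vec n \<longrightarrow> cmat A *\<^sub>v w = \<mu> \<cdot>\<^sub>v w \<longrightarrow>
     cmat C *\<^sub>v w = 0\<^sub>v n \<longrightarrow> w = 0\<^sub>v n)"

text \<open>The energy argument sees only definiteness and dimensions; what the graph contributes is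
  added later, in \<open>msd_network\<close>.\<close>

locale msd =
  fixes N K :: nat and M R W B :: "real mat"
  assumes M: "pos_def_mat N M" and R: "pos_semidef_mat N R" and W: "pos_def_mat K W"
    and B: "B \<in> carrier_mat N K"
begin

abbreviation "Mi \<equiv> minv M"
abbreviation "L \<equiv> B * W * B\<^sup>T"

lemma carrier [simp]:
  "M \<in> carrier_mat N N" "R \<in> carrier_mat N N" "W \<in> carrier_mat K K" "B \<in> carrier_mat N K"
  "B\<^sup>T \<in> carrier_mat K N" "Mi \<in> carrier_mat N N" "L \<in> carrier_mat N N"
proof -
  show c: "M \<in> carrier_mat N N" "R \<in> carrier_mat N N" "W \<in> carrier_mat K K" "B \<in> carrier_mat N K"
    "B\<^sup>T \<in> carrier_mat K N"
    using M R W B by (auto simp: pos_def_mat_def pos_semidef_mat_def)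
  show "Mi \<in> carrier_mat N N" using minv_inverts(1)[OF c(1) pos_def_inj[OF M]] .
  show "L \<in> carrier_mat N N" using c by (meson mult_carrier_mat)
qed

lemma dims [simp]:
  "dim_row M = N" "dim_row R = N" "dim_row W = K" "dim_row B = N" "dim_row Mi = N"
  "dim_col M = N" "dim_col R = N" "dim_col W = K" "dim_col B = K" "dim_col Mi = N"
  using carrier by (meson carrier_matD)+

lemma in_carrier [simp]:
  "x \<in> carrier_vec N \<Longrightarrow> M *\<^sub>v x \<in> carrier_vec N" "x \<in> carrier_vec N \<Longrightarrow> R *\<^sub>v x \<in> carrier_vec N"
  "x \<in> carrier_vec N \<Longrightarrow> Mi *\<^sub>v x \<in> carrier_vec N" "u \<in> carrier_vec K \<Longrightarrow> W *\<^sub>v u \<in> carrier_vec K"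
  "u \<in> carrier_vec K \<Longrightarrow> B *\<^sub>v u \<in> carrier_vec N" "x \<in> carrier_vec N \<Longrightarrow> B\<^sup>T *\<^sub>v x \<in> carrier_vec K"
  by (auto intro!: mult_mat_vec_carrier)

lemma transpose_id: "M\<^sup>T = M" "R\<^sup>T = R" "W\<^sup>T = W"
  using M R W by (auto simp: pos_def_mat_def pos_semidef_mat_def)

lemma M_Mi [simp]:
  "x \<in> carrier_vec N \<Longrightarrow> M *\<^sub>v (Mi *\<^sub>v x) = x" "x \<in> carrier_vec N \<Longrightarrow> Mi *\<^sub>v (M *\<^sub>v x) = x"
  by (rule minv_mult_vec[OF carrier(1) pos_def_inj[OF M]]; assumption)+

lemma adjoint:
  "x \<in> carrier_vec N \<Longrightarrow> y \<in> carrier_vec N \<Longrightarrow> x \<bullet> (M *\<^sub>v y) = (M *\<^sub>v x) \<bullet> y"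
  "x \<in> carrier_vec N \<Longrightarrow> y \<in> carrier_vec N \<Longrightarrow> x \<bullet> (R *\<^sub>v y) = (R *\<^sub>v x) \<bullet> y"
  "u \<in> carrier_vec K \<Longrightarrow> w \<in> carrier_vec K \<Longrightarrow> u \<bullet> (W *\<^sub>v w) = (W *\<^sub>v u) \<bullet> w"
  "x \<in> carrier_vec N \<Longrightarrow> u \<in> carrier_vec K \<Longrightarrow> x \<bullet> (B *\<^sub>v u) = (B\<^sup>T *\<^sub>v x) \<bullet> u"
  "u \<in> carrier_vec K \<Longrightarrow> y \<in> carrier_vec N \<Longrightarrow> u \<bullet> (B\<^sup>T *\<^sub>v y) = (B *\<^sub>v u) \<bullet> y"
  using mult_mat_vec_scalar_prod[of M N N x y] mult_mat_vec_scalar_prod[of R N N x y]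
    mult_mat_vec_scalar_prod[of W K K u w] mult_mat_vec_scalar_prod[of B N K x u]
    mult_mat_vec_scalar_prod[of "B\<^sup>T" K N u y]
  by (auto simp: transpose_id)

lemma adjoint_Mi: "x \<in> carrier_vec N \<Longrightarrow> y \<in> carrier_vec N \<Longrightarrow> x \<bullet> (Mi *\<^sub>v y) = (Mi *\<^sub>v x) \<bullet> y"
  using adjoint(1)[of "Mi *\<^sub>v x" "Mi *\<^sub>v y"] by simp

lemma L_mult_vec: "x \<in> carrier_vec N \<Longrightarrow> L *\<^sub>v x = B *\<^sub>v (W *\<^sub>v (B\<^sup>T *\<^sub>v x))"
  using assoc_mult_mat_vec[of "B * W" N K "B\<^sup>T" N x] assoc_mult_mat_vec[of B N K W K "B\<^sup>T *\<^sub>v x"]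
  by (simp add: mult_carrier_mat[of B N K W K])

lemma L_quadratic_form:
  "x \<in> carrier_vec N \<Longrightarrow> y \<in> carrier_vec N \<Longrightarrow> x \<bullet> (L *\<^sub>v y) = (B\<^sup>T *\<^sub>v x) \<bullet> (W *\<^sub>v (B\<^sup>T *\<^sub>v y))"
  by (simp add: L_mult_vec adjoint)

lemma quadratic_form_commute:
  "x \<in> carrier_vec N \<Longrightarrow> y \<in> carrier_vec N \<Longrightarrow> x \<bullet> (M *\<^sub>v y) = y \<bullet> (M *\<^sub>v x)"
  "x \<in> carrier_vec N \<Longrightarrow> y \<in> carrier_vec N \<Longrightarrow> x \<bullet> (L *\<^sub>v y) = y \<bullet> (L *\<^sub>v x)"
  using comm_scalar_prod[of "M *\<^sub>v x" N y] comm_scalar_prod[of "W *\<^sub>v (B\<^sup>T *\<^sub>v x)" K "B\<^sup>T *\<^sub>v y"]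
  by (simp_all add: adjoint(1,3) L_quadratic_form)

lemma L_kernel:
  assumes "x \<in> carrier_vec N" "L *\<^sub>v x = 0\<^sub>v N"
  shows "B\<^sup>T *\<^sub>v x = 0\<^sub>v K"
proof (rule ccontr)
  assume "B\<^sup>T *\<^sub>v x \<noteq> 0\<^sub>v K"
  then have "0 < x \<bullet> (L *\<^sub>v x)" using W assms(1) by (simp add: pos_def_mat_def L_quadratic_form)
  then show False using assms by simp
qed

end

section \<open>The homogeneous system: energy, bounded functionals and decay of the
  dissipation\<close>

locale msd_homogeneous = msd +
  fixes p q :: "real \<Rightarrow> real vec"
  assumes p: "\<And>t. t \<ge> 0 \<Longrightarrow> p t \<in> carrier_vec N" and q: "\<And>t. t \<ge> 0 \<Longrightarrow> q t \<in> carrier_vec K"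
    and p': "\<And>t. t \<ge> 0 \<Longrightarrow>
      has_deriv_vec p (- (R *\<^sub>v (Mi *\<^sub>v p t)) - B *\<^sub>v (W *\<^sub>v q t)) (at t within {0..})"
    and q': "\<And>t. t \<ge> 0 \<Longrightarrow> has_deriv_vec q (B\<^sup>T *\<^sub>v (Mi *\<^sub>v p t)) (at t within {0..})"
begin

definition y :: "real \<Rightarrow> real vec" where "y t = Mi *\<^sub>v p t"

definition dy :: "real \<Rightarrow> real vec" where "dy t = Mi *\<^sub>v (- (R *\<^sub>v y t) - B *\<^sub>v (W *\<^sub>v q t))"

lemma y_carrier [simp]: "t \<ge> 0 \<Longrightarrow> y t \<in> carrier_vec N"
  using p by (simp add: y_def)

lemma dy_carrier [simp]: "t \<ge> 0 \<Longrightarrow> dy t \<in> carrier_vec N"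
  using q by (simp add: dy_def)

lemma dim_vec_y_q [simp]: "t \<ge> 0 \<Longrightarrow> dim_vec (y t) = N" "t \<ge> 0 \<Longrightarrow> dim_vec (q t) = K"
  using y_carrier q by (auto dest: carrier_vecD)

lemma dp_carrier: "t \<ge> 0 \<Longrightarrow> - (R *\<^sub>v y t) - B *\<^sub>v (W *\<^sub>v q t) \<in> carrier_vec N"
  using q by simp

lemma y_deriv: "t \<ge> 0 \<Longrightarrow> has_deriv_vec y (dy t) (at t within {0..})"
  unfolding y_def[abs_def] dy_def
  by (rule has_deriv_vec_mult_mat[OF p', where n=N]) (use p p' q in \<open>auto simp: y_def\<close>)

lemma q_deriv: "t \<ge> 0 \<Longrightarrow> has_deriv_vec q (B\<^sup>T *\<^sub>v y t) (at t within {0..})"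
  using q' by (simp add: y_def)

definition lin :: "real vec \<Rightarrow> real vec \<Rightarrow> real \<Rightarrow> real" where
  "lin a b t = a \<bullet> y t + b \<bullet> q t"

text \<open>The new coefficients are the transposed system matrix applied to \<open>(a, b)\<close>,
  found by moving \<open>R\<close>, \<open>Mi\<close>, \<open>B\<close> and \<open>W\<close> across
  the scalar product. Differentiation thus maps functionals of the state to functionals of the
  state, so that bounds and Barbalat's lemma can be iterated.\<close>

definition lin' :: "real vec \<Rightarrow> real vec \<Rightarrow> real \<Rightarrow> real" where
  "lin' a b = lin (- (R *\<^sub>v (Mi *\<^sub>v a)) + B *\<^sub>v b) (- (W *\<^sub>v (B\<^sup>T *\<^sub>v (Mi *\<^sub>v a))))"

lemma dy_scalar_prod:
  assumes "a \<in> carrier_vec N" "t \<ge> 0"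
  shows "a \<bullet> dy t = - ((R *\<^sub>v (Mi *\<^sub>v a)) \<bullet> y t) - (W *\<^sub>v (B\<^sup>T *\<^sub>v (Mi *\<^sub>v a))) \<bullet> q t"
proof -
  have "a \<bullet> dy t = (Mi *\<^sub>v a) \<bullet> (- (R *\<^sub>v y t) - B *\<^sub>v (W *\<^sub>v q t))"
    unfolding dy_def using assms dp_carrier by (simp add: adjoint_Mi)
  also have "\<dots> = - ((Mi *\<^sub>v a) \<bullet> (R *\<^sub>v y t)) - (Mi *\<^sub>v a) \<bullet> (B *\<^sub>v (W *\<^sub>v q t))"
    using assms q by (simp add: scalar_prod_minus_distrib[of _ N])
  finally show ?thesis using assms q by (simp add: adjoint)
qed

lemma lin_deriv:
  assumes "a \<in> carrier_vec N" "b \<in> carrier_vec K" "t \<ge> 0"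
  shows "(lin a b has_real_derivative lin' a b t) (at t within {0..})"
proof -
  have "((\<lambda>s. a \<bullet> y s) has_real_derivative a \<bullet> dy t) (at t within {0..})"
    by (rule has_deriv_vec_scalar_prod_const[OF y_deriv, where n=N]) (use assms in auto)
  moreover have "((\<lambda>s. b \<bullet> q s) has_real_derivative b \<bullet> (B\<^sup>T *\<^sub>v y t)) (at t within {0..})"
    by (rule has_deriv_vec_scalar_prod_const[OF q_deriv, where n=K]) (use assms q in auto)
  ultimately have "(lin a b has_real_derivative a \<bullet> dy t + b \<bullet> (B\<^sup>T *\<^sub>v y t)) (at t within {0..})"
    unfolding lin_def[abs_def] by (rule DERIV_add)
  moreover have "a \<bullet> dy t + b \<bullet> (B\<^sup>T *\<^sub>v y t) = lin' a b t"
    using assms q[of t]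
    by (simp add: dy_scalar_prod lin'_def lin_def adjoint add_scalar_prod_distrib[of _ N])
  ultimately show ?thesis by simp
qed

text \<open>Twice the physical energy: as \<open>y = Mi p\<close>, the first term is
  \<open>p . Mi p\<close>, and the second is the potential of the springs.\<close>

definition energy :: "real \<Rightarrow> real" where
  "energy t = y t \<bullet> (M *\<^sub>v y t) + q t \<bullet> (W *\<^sub>v q t)"

text \<open>Springs and masses exchange the power \<open>(B\<^sup>T y) . (W q)\<close>; it occurs
  with opposite signs in the two halves of the energy and cancels, so only friction is left.\<close>

lemma energy_deriv:
  assumes t: "t \<ge> 0"
  shows "(energy has_real_derivative - 2 * (y t \<bullet> (R *\<^sub>v y t))) (at t within {0..})"
proof -
  have My: "has_deriv_vec (\<lambda>t. M *\<^sub>v y t) (M *\<^sub>v dy t) (at t within {0..})"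
    by (rule has_deriv_vec_mult_mat[OF y_deriv, where n=N]) (use t in auto)
  have Wq: "has_deriv_vec (\<lambda>t. W *\<^sub>v q t) (W *\<^sub>v (B\<^sup>T *\<^sub>v y t)) (at t within {0..})"
    by (rule has_deriv_vec_mult_mat[OF q_deriv, where n=K]) (use t q in auto)
  have "(energy has_real_derivative (dy t \<bullet> (M *\<^sub>v y t) + y t \<bullet> (M *\<^sub>v dy t))
      + ((B\<^sup>T *\<^sub>v y t) \<bullet> (W *\<^sub>v q t) + q t \<bullet> (W *\<^sub>v (B\<^sup>T *\<^sub>v y t)))) (at t within {0..})"
    unfolding energy_def[abs_def]
    by (intro DERIV_add has_deriv_vec_scalar_prod[OF y_deriv My, of N]
        has_deriv_vec_scalar_prod[OF q_deriv Wq, of K]) (use t q in auto)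
  moreover have "dy t \<bullet> (M *\<^sub>v y t) = y t \<bullet> (M *\<^sub>v dy t)"
    using t by (simp add: adjoint comm_scalar_prod[of _ N])
  moreover have "q t \<bullet> (W *\<^sub>v (B\<^sup>T *\<^sub>v y t)) = (B\<^sup>T *\<^sub>v y t) \<bullet> (W *\<^sub>v q t)"
    using t q[of t] by (simp add: adjoint(3) comm_scalar_prod[of _ K])
  moreover have "y t \<bullet> (M *\<^sub>v dy t) = - (y t \<bullet> (R *\<^sub>v y t)) - (B\<^sup>T *\<^sub>v y t) \<bullet> (W *\<^sub>v q t)"
  proof -
    have "M *\<^sub>v dy t = - (R *\<^sub>v y t) - B *\<^sub>v (W *\<^sub>v q t)"
      unfolding dy_def using dp_carrier[OF t] by simp
    then show ?thesis
      using t q[of t] by (simp add: scalar_prod_minus_distrib[of _ N] adjoint(4)[symmetric])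
  qed
  ultimately show ?thesis by simp
qed

lemma dissipation_nonneg: "t \<ge> 0 \<Longrightarrow> y t \<bullet> (R *\<^sub>v y t) \<ge> 0"
  using R by (simp add: pos_semidef_mat_def)

lemma energy_nonneg:
  assumes "t \<ge> 0" shows "0 \<le> y t \<bullet> (M *\<^sub>v y t)" "0 \<le> q t \<bullet> (W *\<^sub>v q t)"
  using pos_def_imp_semidef[OF M] pos_def_imp_semidef[OF W] assms q by (simp_all add: pos_semidef_mat_def)

lemma energy_ge_0: "t \<ge> 0 \<Longrightarrow> 0 \<le> energy t"
  using energy_nonneg by (simp add: energy_def)

lemma energy_nonincreasing:
  assumes "0 \<le> s" "s \<le> t"
  shows "energy t \<le> energy s"
proof (rule DERIV_nonpos_imp_decreasing_open[OF assms(2)])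
  fix x assume "s < x"
  then have x: "x > 0" using assms by simp
  then have "DERIV energy x :> - 2 * (y x \<bullet> (R *\<^sub>v y x))"
    using energy_deriv[of x] at_within_open_subset[of x "{0<..}" "{0..}"] by (simp add: subset_eq)
  then show "\<exists>d. DERIV energy x :> d \<and> d \<le> 0" using dissipation_nonneg[of x] x by force
next
  show "continuous_on {s..t} energy"
    using assms(1)
    by (intro continuous_on_subset[OF DERIV_continuous_on[of "{0..}" energy "\<lambda>t. - 2 * (y t \<bullet> (R *\<^sub>v y t))"]])
      (use energy_deriv in auto)
qed

text \<open>The Cauchy-Schwarz inequality for the forms \<open>M\<close> and \<open>W\<close> replaces eigenvalue bounds.\<close>

lemma lin_bounded:
  assumes a: "a \<in> carrier_vec N" and b: "b \<in> carrier_vec K"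
  shows "\<exists>C. \<forall>t\<ge>0. \<bar>lin a b t\<bar> \<le> C"
proof -
  \<comment> \<open>Writing \<open>a = M (Mi a)\<close> and \<open>b = W ?wb\<close> turns
    \<open>a . y\<close> and \<open>b . q\<close> into products for the forms \<open>M\<close> and
    \<open>W\<close>, to which Cauchy-Schwarz applies.\<close>
  let ?wb = "minv W *\<^sub>v b"
  have Wi: "minv W \<in> carrier_mat K K" "W *\<^sub>v ?wb = b"
    using minv_inverts(1)[OF carrier(3) pos_def_inj[OF W]]
      minv_mult_vec(1)[OF carrier(3) pos_def_inj[OF W] b] by blast+
  have wb: "?wb \<in> carrier_vec K" using mult_mat_vec_carrier[OF Wi(1) b] .
  have pos: "0 \<le> (Mi *\<^sub>v a) \<bullet> (M *\<^sub>v (Mi *\<^sub>v a))" "0 \<le> ?wb \<bullet> (W *\<^sub>v ?wb)"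
    using pos_def_imp_semidef[OF M] pos_def_imp_semidef[OF W] in_carrier(3)[OF a] wb
    unfolding pos_semidef_mat_def by blast+
  let ?C = "sqrt (((Mi *\<^sub>v a) \<bullet> a) * energy 0) + sqrt ((?wb \<bullet> b) * energy 0)"
  have "\<bar>lin a b t\<bar> \<le> ?C" if t: "t \<ge> 0" for t
  proof -
    have e: "y t \<bullet> (M *\<^sub>v y t) \<le> energy 0" "q t \<bullet> (W *\<^sub>v q t) \<le> energy 0"
      using energy_nonneg[OF t] energy_nonincreasing[of 0 t] t by (auto simp: energy_def)
    have "(a \<bullet> y t)\<^sup>2 = ((Mi *\<^sub>v a) \<bullet> (M *\<^sub>v y t))\<^sup>2"
      using a t by (simp add: adjoint)
    also have "\<dots> \<le> ((Mi *\<^sub>v a) \<bullet> (M *\<^sub>v (Mi *\<^sub>v a))) * (y t \<bullet> (M *\<^sub>v y t))"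
      by (rule pos_semidef_cauchy_schwarz[OF pos_def_imp_semidef[OF M]]) (use a t in auto)
    also have "\<dots> \<le> ((Mi *\<^sub>v a) \<bullet> (M *\<^sub>v (Mi *\<^sub>v a))) * energy 0"
      by (intro mult_left_mono e pos)
    finally have 1: "\<bar>a \<bullet> y t\<bar> \<le> sqrt (((Mi *\<^sub>v a) \<bullet> a) * energy 0)"
      using a by (intro real_le_rsqrt) simp
    have "(b \<bullet> q t)\<^sup>2 = (?wb \<bullet> (W *\<^sub>v q t))\<^sup>2"
      using b t wb Wi q[of t] by (simp add: adjoint)
    also have "\<dots> \<le> (?wb \<bullet> (W *\<^sub>v ?wb)) * (q t \<bullet> (W *\<^sub>v q t))"
      by (rule pos_semidef_cauchy_schwarz[OF pos_def_imp_semidef[OF W]]) (use wb t q in auto)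
    also have "\<dots> \<le> (?wb \<bullet> (W *\<^sub>v ?wb)) * energy 0"
      by (intro mult_left_mono e pos)
    finally have 2: "\<bar>b \<bullet> q t\<bar> \<le> sqrt ((?wb \<bullet> b) * energy 0)"
      using b Wi by (intro real_le_rsqrt) simp
    show ?thesis using abs_triangle_ineq[of "a \<bullet> y t" "b \<bullet> q t"] 1 2 unfolding lin_def by linarith
  qed
  then show ?thesis by blast
qed

lemma lin'_bounded:
  assumes "a \<in> carrier_vec N" "b \<in> carrier_vec K"
  shows "\<exists>C. \<forall>t\<ge>0. \<bar>lin' a b t\<bar> \<le> C"
  unfolding lin'_def using assms by (intro lin_bounded) auto

text \<open>The second derivative of a functional is again a functional, hence bounded, which is
  what Barbalat's lemma asks for.\<close>

lemma lin'_tendsto_0: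
  assumes "a \<in> carrier_vec N" "b \<in> carrier_vec K" "(lin a b \<longlongrightarrow> 0) at_top"
  shows "(lin' a b \<longlongrightarrow> 0) at_top"
proof -
  let ?a = "- (R *\<^sub>v (Mi *\<^sub>v a)) + B *\<^sub>v b" and ?b = "- (W *\<^sub>v (B\<^sup>T *\<^sub>v (Mi *\<^sub>v a)))"
  have c: "?a \<in> carrier_vec N" "?b \<in> carrier_vec K" using assms by auto
  obtain C where C: "\<And>t. t \<ge> 0 \<Longrightarrow> \<bar>lin' ?a ?b t\<bar> \<le> C" using lin'_bounded[OF c] by blast
  show ?thesis
  proof (rule barbalat[OF _ _ C assms(3)])
    show "(lin' a b has_real_derivative lin' ?a ?b t) (at t within {0..})" if "t \<ge> 0" for t
      unfolding lin'_def[of a b] by (rule lin_deriv[OF c that])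
  qed (use assms lin_deriv in auto)
qed

text \<open>Barbalat's lemma for the energy, which converges because it is nonincreasing and
  nonnegative. Its second derivative is quadratic in the state, so the bounds for linear functionals
  have to be applied factor by factor.\<close>

lemma dissipation_tendsto_0: "((\<lambda>t. y t \<bullet> (R *\<^sub>v y t)) \<longlongrightarrow> 0) at_top"
proof -
  obtain l where l: "(energy \<longlongrightarrow> l) at_top"
    using nonincreasing_bounded_tendsto[where f=energy and c=0, OF energy_nonincreasing energy_ge_0] by blast
  \<comment> \<open>This is \<open>-4 * (dy . R y)\<close> in coordinates, each factor being a
    bounded functional; the 4 is the factor 2 of \<open>energy_deriv\<close> times the 2 from
    differentiating a quadratic form.\<close>
  let ?h = "\<lambda>t. - 4 * (\<Sum>i<N. (unit_vec N i \<bullet> dy t) * ((R *\<^sub>v unit_vec N i) \<bullet> y t))"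
  have d: "((\<lambda>t. - 2 * (y t \<bullet> (R *\<^sub>v y t))) has_real_derivative ?h t) (at t within {0..})"
    if t: "t \<ge> 0" for t
  proof -
    have Ry: "has_deriv_vec (\<lambda>t. R *\<^sub>v y t) (R *\<^sub>v dy t) (at t within {0..})"
      by (rule has_deriv_vec_mult_mat[OF y_deriv, where n=N]) (use t in auto)
    have "((\<lambda>t. y t \<bullet> (R *\<^sub>v y t)) has_real_derivative dy t \<bullet> (R *\<^sub>v y t) + y t \<bullet> (R *\<^sub>v dy t))
        (at t within {0..})"
      by (rule has_deriv_vec_scalar_prod[OF y_deriv Ry, of N]) (use t in auto)
    moreover have "y t \<bullet> (R *\<^sub>v dy t) = dy t \<bullet> (R *\<^sub>v y t)"
      using t by (simp add: adjoint(2) comm_scalar_prod[of _ N])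
    moreover have "dy t \<bullet> (R *\<^sub>v y t) = (\<Sum>i<N. (unit_vec N i \<bullet> dy t) * ((R *\<^sub>v unit_vec N i) \<bullet> y t))"
    proof -
      have "(R *\<^sub>v unit_vec N i) \<bullet> y t = (R *\<^sub>v y t) $ i" if "i < N" for i
        using that t adjoint(2)[of "unit_vec N i" "y t"] scalar_prod_left_unit[of "R *\<^sub>v y t" N i]
        by simp
      moreover have "unit_vec N i \<bullet> dy t = dy t $ i" if "i < N" for i
        using that t by simp
      ultimately show ?thesis
        unfolding scalar_prod_def[of "dy t"] by (simp add: atLeast0LessThan)
    qed
    ultimately have "((\<lambda>t. y t \<bullet> (R *\<^sub>v y t)) has_real_derivative
        2 * (\<Sum>i<N. (unit_vec N i \<bullet> dy t) * ((R *\<^sub>v unit_vec N i) \<bullet> y t))) (at t within {0..})"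
      by simp
    from DERIV_cmult[OF this, of "-2"] show ?thesis by simp
  qed
  have "\<forall>i. \<exists>C. \<forall>t\<ge>0. \<bar>unit_vec N i \<bullet> dy t\<bar> \<le> C"
  proof
    fix i
    obtain C where C: "\<forall>t\<ge>0. \<bar>lin' (unit_vec N i) (0\<^sub>v K) t\<bar> \<le> C"
      using lin'_bounded[of "unit_vec N i" "0\<^sub>v K"] by fastforce
    have B0: "B *\<^sub>v 0\<^sub>v K = 0\<^sub>v N" by (intro eq_vecI) auto
    have "unit_vec N i \<bullet> dy t = lin' (unit_vec N i) (0\<^sub>v K) t" if "t \<ge> 0" for t
      using that q[of t] B0
      by (simp add: lin'_def lin_def dy_scalar_prod
        del: scalar_prod_left_unit)
    then show "\<exists>C. \<forall>t\<ge>0. \<bar>unit_vec N i \<bullet> dy t\<bar> \<le> C"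
      using C by (intro exI[of _ C]) (simp del: scalar_prod_left_unit)
  qed
  from choice[OF this] obtain C1 where C1: "\<And>i t. t \<ge> 0 \<Longrightarrow> \<bar>unit_vec N i \<bullet> dy t\<bar> \<le> C1 i"
    by auto
  have "\<forall>i. \<exists>C. \<forall>t\<ge>0. \<bar>(R *\<^sub>v unit_vec N i) \<bullet> y t\<bar> \<le> C"
  proof
    fix i
    show "\<exists>C. \<forall>t\<ge>0. \<bar>(R *\<^sub>v unit_vec N i) \<bullet> y t\<bar> \<le> C"
      using lin_bounded[of "R *\<^sub>v unit_vec N i" "0\<^sub>v K"] q by (auto simp: lin_def)
  qed
  from choice[OF this]
  obtain C2 where C2: "\<And>i t. t \<ge> 0 \<Longrightarrow> \<bar>(R *\<^sub>v unit_vec N i) \<bullet> y t\<bar> \<le> C2 i"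
    by auto
  have "\<bar>?h t\<bar> \<le> 4 * (\<Sum>i<N. C1 i * C2 i)" if t: "t \<ge> 0" for t
  proof -
    have "\<bar>\<Sum>i<N. (unit_vec N i \<bullet> dy t) * ((R *\<^sub>v unit_vec N i) \<bullet> y t)\<bar> \<le> (\<Sum>i<N. C1 i * C2 i)"
    proof (rule order_trans[OF sum_abs sum_mono])
      fix i
      show "\<bar>(unit_vec N i \<bullet> dy t) * ((R *\<^sub>v unit_vec N i) \<bullet> y t)\<bar> \<le> C1 i * C2 i"
        unfolding abs_mult
        using mult_mono[OF C1[OF t] C2[OF t] order_trans[OF abs_ge_zero C1[OF t]] abs_ge_zero] .
    qed
    then show ?thesis by (simp add: abs_mult)
  qed
  with energy_deriv d
  have "((\<lambda>t. - 2 * (y t \<bullet> (R *\<^sub>v y t))) \<longlongrightarrow> 0) at_top"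
    by (rule barbalat[OF _ _ _ l])
  from tendsto_mult_left[OF this, of "-1/2"] show ?thesis by simp
qed

section \<open>Functionals of the output that die out, and their annihilator\<close>

definition vanishing :: "real vec set" where
  "vanishing = {s \<in> carrier_vec N. ((\<lambda>t. s \<bullet> y t) \<longlongrightarrow> 0) at_top}"

text \<open>Cauchy-Schwarz for the form \<open>R\<close> bounds the square of
  \<open>(R x) . y\<close> by \<open>x . R x\<close> times the dissipation, which tends to
  0.\<close>

lemma R_in_vanishing:
  assumes x: "x \<in> carrier_vec N"
  shows "R *\<^sub>v x \<in> vanishing"
proof -
  have "((\<lambda>t. (x \<bullet> (R *\<^sub>v x)) * (y t \<bullet> (R *\<^sub>v y t))) \<longlongrightarrow> 0) at_top"
    using tendsto_mult_left[OF dissipation_tendsto_0, of "x \<bullet> (R *\<^sub>v x)"] by simp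
  then have "((\<lambda>t. ((R *\<^sub>v x) \<bullet> y t)\<^sup>2) \<longlongrightarrow> 0) at_top"
  proof (rule tendsto_sandwich[rotated 3])
    show "\<forall>\<^sub>F t in at_top. ((R *\<^sub>v x) \<bullet> y t)\<^sup>2 \<le> (x \<bullet> (R *\<^sub>v x)) * (y t \<bullet> (R *\<^sub>v y t))"
      using eventually_ge_at_top[of 0]
      by eventually_elim
        (use pos_semidef_cauchy_schwarz[OF R x] x in \<open>auto simp: adjoint(2)\<close>)
  qed auto
  then have "((\<lambda>t. sqrt (((R *\<^sub>v x) \<bullet> y t)\<^sup>2)) \<longlongrightarrow> sqrt 0) at_top" by (rule tendsto_real_sqrt)
  then have "((\<lambda>t. (R *\<^sub>v x) \<bullet> y t) \<longlongrightarrow> 0) at_top" by (simp add: tendsto_rabs_zero_iff)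
  then show ?thesis using x by (simp add: vanishing_def)
qed

text \<open>Differentiate \<open>s \<bullet> y\<close> twice. The derivative is a functional of \<open>y\<close> in the range of \<open>R\<close>, which
  tends to 0, plus a functional of \<open>q\<close>, whose derivative is \<open>(L (Mi s)) \<bullet> y\<close> up to sign.\<close>

lemma L_Mi_in_vanishing:
  assumes s: "s \<in> vanishing"
  shows "L *\<^sub>v (Mi *\<^sub>v s) \<in> vanishing"
proof -
  have sc: "s \<in> carrier_vec N" and s0: "((\<lambda>t. s \<bullet> y t) \<longlongrightarrow> 0) at_top" using s by (auto simp: vanishing_def)
  let ?b = "W *\<^sub>v (B\<^sup>T *\<^sub>v (Mi *\<^sub>v s))"
  have b: "?b \<in> carrier_vec K" using sc by simp
  have ev: "\<forall>\<^sub>F t in at_top. t \<ge> (0::real)" by (rule eventually_ge_at_top)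
  have B0: "B *\<^sub>v 0\<^sub>v K = 0\<^sub>v N" and Mi0: "Mi *\<^sub>v 0\<^sub>v N = 0\<^sub>v N" and R0: "R *\<^sub>v 0\<^sub>v N = 0\<^sub>v N"
    and BT0: "B\<^sup>T *\<^sub>v 0\<^sub>v N = 0\<^sub>v K" and W0: "W *\<^sub>v 0\<^sub>v K = 0\<^sub>v K" by (intro eq_vecI; auto)+
  have "(lin s (0\<^sub>v K) \<longlongrightarrow> 0) at_top"
    using s0 by (rule Lim_transform_eventually[OF _ eventually_mono[OF ev]]) (use q in \<open>simp add: lin_def\<close>)
  from lin'_tendsto_0[OF sc _ this]
  have "(lin' s (0\<^sub>v K) \<longlongrightarrow> 0) at_top" by simp
  moreover have "((\<lambda>t. (R *\<^sub>v (Mi *\<^sub>v s)) \<bullet> y t) \<longlongrightarrow> 0) at_top"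
    using R_in_vanishing[of "Mi *\<^sub>v s"] sc by (simp add: vanishing_def)
  \<comment> \<open>Up to sign, \<open>lin' s 0\<close> is the sum of the friction functional and
    \<open>?b . q\<close>. The first two tend to 0, hence so does \<open>?b . q\<close>, and
    Barbalat's lemma can be applied a second time.\<close>
  ultimately have "((\<lambda>t. - ((R *\<^sub>v (Mi *\<^sub>v s)) \<bullet> y t) - lin' s (0\<^sub>v K) t) \<longlongrightarrow> - 0 - 0) at_top"
    by (intro tendsto_intros)
  then have "(lin (0\<^sub>v N) ?b \<longlongrightarrow> 0) at_top"
    unfolding minus_zero diff_0_right
    by (rule Lim_transform_eventually[OF _ eventually_mono[OF ev]])
      (use q sc B0 in \<open>simp add: lin_def lin'_def\<close>)
  from lin'_tendsto_0[OF _ b this]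
  have "(lin' (0\<^sub>v N) ?b \<longlongrightarrow> 0) at_top" by simp
  then have "((\<lambda>t. (B *\<^sub>v ?b) \<bullet> y t) \<longlongrightarrow> 0) at_top"
    by (rule Lim_transform_eventually[OF _ eventually_mono[OF ev]])
      (use q sc B0 Mi0 R0 BT0 W0 in \<open>simp add: lin_def lin'_def\<close>)
  then show ?thesis using sc by (simp add: vanishing_def L_mult_vec)
qed

text \<open>Sampling at times \<open>T j\<close> where entry \<open>i\<close> stays at least
  \<open>e\<close> in absolute value and passing to a convergent subsequence gives a limit whose
  entry \<open>i\<close> is nonzero. A functional that tends to 0 along the whole trajectory must
  vanish on this limit.\<close>

lemma output_cluster_point:
  assumes i: "i < N" and not: "\<not> ((\<lambda>t. y t $ i) \<longlongrightarrow> 0) at_top"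
  shows "\<exists>z\<in>carrier_vec N. z \<noteq> 0\<^sub>v N \<and> (\<forall>s\<in>vanishing. s \<bullet> z = 0)"
proof -
  obtain e where e: "e > 0" "\<not> (\<forall>\<^sub>F t in at_top. dist (y t $ i) 0 < e)"
    using not by (auto simp: tendsto_iff)
  then have "\<exists>t\<ge>real j. \<bar>y t $ i\<bar> \<ge> e" for j
    by (auto simp: eventually_at_top_linorder dist_real_def not_less)
  then obtain T where T: "\<And>j. T j \<ge> real j" "\<And>j. \<bar>y (T j) $ i\<bar> \<ge> e" by metis
  have T0: "T j \<ge> 0" for j using T(1)[of j] by linarith
  have "\<exists>C. \<forall>j. \<bar>y (T j) $ k\<bar> \<le> C" if "k < N" for k
  proof -
    obtain C where "\<forall>t\<ge>0. \<bar>lin (unit_vec N k) (0\<^sub>v K) t\<bar> \<le> C"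
      using lin_bounded[of "unit_vec N k" "0\<^sub>v K"] by auto
    moreover have "lin (unit_vec N k) (0\<^sub>v K) t = y t $ k" if "t \<ge> 0" for t
      using that \<open>k < N\<close> q[of t] by (simp add: lin_def)
    ultimately have "\<bar>y (T j) $ k\<bar> \<le> C" for j using T0[of j] by metis
    then show ?thesis by blast
  qed
  from bounded_family_convergent_subseq[of N "\<lambda>j k. y (T j) $ k", OF this]
  obtain \<rho> l where \<rho>: "strict_mono \<rho>" "\<And>k. k < N \<Longrightarrow> (\<lambda>j. y (T (\<rho> j)) $ k) \<longlonglongrightarrow> l k" by auto
  let ?z = "vec N l"
  have Tlim: "filterlim (\<lambda>j. T (\<rho> j)) at_top sequentially"
  proof (rule filterlim_at_top_mono[OF filterlim_real_sequentially])
    show "\<forall>\<^sub>F j in sequentially. real j \<le> T (\<rho> j)"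
    proof (intro always_eventually allI)
      fix j
      show "real j \<le> T (\<rho> j)" using T(1)[of "\<rho> j"] seq_suble[OF \<rho>(1), of j] by linarith
    qed
  qed
  have "e \<le> \<bar>l i\<bar>"
    by (rule tendsto_lowerbound[OF tendsto_rabs[OF \<rho>(2)[OF i]]]) (use T(2) in auto)
  then have "?z \<noteq> 0\<^sub>v N" using e i by (metis abs_zero index_vec index_zero_vec(1) not_less)
  moreover have "s \<bullet> ?z = 0" if s: "s \<in> vanishing" for s
  proof -
    have "(\<lambda>j. s \<bullet> y (T (\<rho> j))) \<longlonglongrightarrow> 0"
      using filterlim_compose[OF _ Tlim, of "\<lambda>t. s \<bullet> y t"] s by (simp add: vanishing_def)
    moreover have "(\<lambda>j. \<Sum>k<N. s $ k * y (T (\<rho> j)) $ k) \<longlonglongrightarrow> (\<Sum>k<N. s $ k * l k)"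
      by (intro tendsto_intros \<rho>) auto
    moreover have "s \<bullet> y (T (\<rho> j)) = (\<Sum>k<N. s $ k * y (T (\<rho> j)) $ k)" for j
      using y_carrier[OF T0[of "\<rho> j"]] by (auto simp: scalar_prod_def atLeast0LessThan)
    ultimately have "(\<Sum>k<N. s $ k * l k) = 0" using LIMSEQ_unique by auto
    then show ?thesis by (simp add: scalar_prod_def atLeast0LessThan)
  qed
  ultimately show ?thesis by (intro bexI[of _ ?z]) auto
qed

lemma vanishing_annihilator_unobservable:
  assumes x: "x \<in> carrier_vec N" and orth: "\<And>s. s \<in> vanishing \<Longrightarrow> s \<bullet> x = 0"
  shows "R *\<^sub>v x = 0\<^sub>v N"
proof (intro eq_vecI)
  fix i assume "i < dim_vec (0\<^sub>v N :: real vec)"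
  then have i: "i < N" by simp
  have "(R *\<^sub>v x) $ i = unit_vec N i \<bullet> (R *\<^sub>v x)"
    using scalar_prod_left_unit[of "R *\<^sub>v x" N i] i x by simp
  also have "\<dots> = (R *\<^sub>v unit_vec N i) \<bullet> x" using x by (simp add: adjoint(2))
  also have "\<dots> = 0" using orth R_in_vanishing[of "unit_vec N i"] by simp
  finally show "(R *\<^sub>v x) $ i = 0\<^sub>v N $ i" using i by simp
qed simp

text \<open>\<open>Mi L\<close> is the adjoint of \<open>L Mi\<close>, under which
  \<open>vanishing\<close> is stable, so the annihilator is stable under
  \<open>Mi L\<close>.\<close>

lemma vanishing_annihilator_invariant:
  assumes x: "x \<in> carrier_vec N" and orth: "\<And>s. s \<in> vanishing \<Longrightarrow> s \<bullet> x = 0" and s: "s \<in> vanishing"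
  shows "s \<bullet> ((Mi * L) *\<^sub>v x) = 0"
proof -
  have sc: "s \<in> carrier_vec N" using s by (simp add: vanishing_def)
  have Lx: "L *\<^sub>v x \<in> carrier_vec N" using x mult_mat_vec_carrier[OF carrier(7)] by blast
  have LMs: "L *\<^sub>v (Mi *\<^sub>v s) \<in> carrier_vec N" using sc mult_mat_vec_carrier[OF carrier(7)] by simp
  have "s \<bullet> ((Mi * L) *\<^sub>v x) = (Mi *\<^sub>v s) \<bullet> (L *\<^sub>v x)"
    using x sc Lx assoc_mult_mat_vec[OF carrier(6,7) x] by (simp add: adjoint_Mi)
  also have "\<dots> = x \<bullet> (L *\<^sub>v (Mi *\<^sub>v s))"
    using quadratic_form_commute(2)[OF in_carrier(3)[OF sc] x] .
  also have "\<dots> = (L *\<^sub>v (Mi *\<^sub>v s)) \<bullet> x" using comm_scalar_prod[OF x LMs] .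
  also have "\<dots> = 0" using orth[OF L_Mi_in_vanishing[OF s]] .
  finally show ?thesis .
qed

lemma output_tendsto_0:
  assumes free: "unobservable_mode_free N (Mi * L) R" and i: "i < N"
  shows "((\<lambda>t. y t $ i) \<longlongrightarrow> 0) at_top"
proof (rule ccontr)
  assume "\<not> ((\<lambda>t. y t $ i) \<longlongrightarrow> 0) at_top"
  then obtain z where z: "z \<in> carrier_vec N" "z \<noteq> 0\<^sub>v N" "\<And>s. s \<in> vanishing \<Longrightarrow> s \<bullet> z = 0"
    using output_cluster_point[OF i] by blast
  have Zc: "s \<in> carrier_vec N" if "s \<in> vanishing" for s using that by (simp add: vanishing_def)
  have MiL: "Mi * L \<in> carrier_mat N N" using mult_carrier_mat[OF carrier(6,7)] .
  let ?cz = "map_vec complex_of_real z"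
  \<comment> \<open>The complexification of the annihilator of \<open>vanishing\<close>: an
    eigenvector is guaranteed only over an algebraically closed field.\<close>
  define S where "S = {w \<in> carrier_vec N. \<forall>s\<in>vanishing. s \<bullet> re_vec w = 0 \<and> s \<bullet> im_vec w = 0}"
  have "\<exists>\<mu> w. w \<in> S \<and> w \<in> carrier_vec N \<and> w \<noteq> 0\<^sub>v N \<and> cmat (Mi * L) *\<^sub>v w = \<mu> \<cdot>\<^sub>v w"
  proof (rule invariant_subspace_eigenvector[of _ N ?cz])
    show "cmat (Mi * L) \<in> carrier_mat N N" using MiL by simp
    show "?cz \<in> carrier_vec N" using z by simp
    show "?cz \<noteq> 0\<^sub>v N" using z(2) re_im_of_real(1)[of z] re_im_zero(1)[of N] by metis
    show "?cz \<in> S" using z Zc by (auto simp: S_def re_im_of_real)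
    show "cmat (Mi * L) *\<^sub>v x \<in> S" if "x \<in> S" for x
      using that vanishing_annihilator_invariant re_im_cmat_mult_vec[OF MiL, of x]
        mult_mat_vec_carrier[of "cmat (Mi * L)" N N x] MiL
      unfolding S_def by simp
    show "u + w \<in> S" if "u \<in> S" "w \<in> S" for u w
      using that Zc by (auto simp: S_def re_im_add[of _ N] scalar_prod_add_distrib[of _ N])
    show "c \<cdot>\<^sub>v w \<in> S" if "w \<in> S" for c w
      using that Zc
      by (auto simp: S_def re_im_smult[of _ N] scalar_prod_add_distrib[of _ N] scalar_prod_minus_distrib[of _ N])
  qed
  then obtain \<mu> w where w: "w \<in> S" "w \<in> carrier_vec N" "w \<noteq> 0\<^sub>v N" "cmat (Mi * L) *\<^sub>v w = \<mu> \<cdot>\<^sub>v w"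
    by blast
  have "R *\<^sub>v re_vec w = 0\<^sub>v N" "R *\<^sub>v im_vec w = 0\<^sub>v N"
    using w by (auto simp: S_def intro!: vanishing_annihilator_unobservable)
  then have "cmat R *\<^sub>v w = 0\<^sub>v N"
    by (intro re_im_vec_eqI) (auto simp: re_im_cmat_mult_vec[OF carrier(2) w(2)] re_im_zero)
  then show False using free w unfolding unobservable_mode_free_def by blast
qed

end

text \<open>The graph and the damped nodes enter through two properties: the kernel of
  \<open>B\<^sup>T\<close> is the consensus space, and a consensus vector without dissipation is
  zero.\<close>

locale msd_network = msd +
  fixes r :: nat and II :: "real mat" and v :: "real vec"
  assumes II: "II \<in> carrier_mat N r" and v: "v \<in> carrier_vec N"
    and consensus: "\<And>x. x \<in> carrier_vec N \<Longrightarrow> B\<^sup>T *\<^sub>v x = 0\<^sub>v K \<longleftrightarrow> x \<in> mat_image II"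
    and damped_consensus:
      "\<And>x. x \<in> carrier_vec N \<Longrightarrow> B\<^sup>T *\<^sub>v x = 0\<^sub>v K \<Longrightarrow> x \<bullet> (R *\<^sub>v x) = 0 \<Longrightarrow> x = 0\<^sub>v N"
begin

text \<open>The matrix \<open>G = L + R II II\<^sup>T\<close> is invertible, and \<open>G z = v\<close> says that \<open>(II II\<^sup>T z, B\<^sup>T z)\<close> is an
  equilibrium (in the variables \<open>y\<close>, \<open>q\<close>).\<close>

lemma equilibrium:
  "\<exists>yb\<in>mat_image II. \<exists>qb\<in>carrier_vec K. R *\<^sub>v yb + B *\<^sub>v (W *\<^sub>v qb) = v"
proof -
  define J where "J = II * II\<^sup>T"
  have IIT: "II\<^sup>T \<in> carrier_mat r N" using II by simp
  have J: "J \<in> carrier_mat N N" and RJ: "R * J \<in> carrier_mat N N" using II by (auto simp: J_def)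
  have Jx: "J *\<^sub>v x = II *\<^sub>v (II\<^sup>T *\<^sub>v x)" if "x \<in> carrier_vec N" for x
    unfolding J_def using assoc_mult_mat_vec[OF II IIT that] .
  have Jc: "J *\<^sub>v x \<in> carrier_vec N" if "x \<in> carrier_vec N" for x
    using mult_mat_vec_carrier[OF J that] .
  have Jim: "J *\<^sub>v x \<in> mat_image II" if "x \<in> carrier_vec N" for x
    unfolding mat_image_def Jx[OF that] using II mult_mat_vec_carrier[OF IIT that] by auto
  have Lc: "L *\<^sub>v x \<in> carrier_vec N" if "x \<in> carrier_vec N" for x
    using mult_mat_vec_carrier[OF carrier(7) that] .
  define G where "G = L + R * J"
  have G: "G \<in> carrier_mat N N" unfolding G_def using RJ carrier(7) by (meson add_carrier_mat)
  have Gx: "G *\<^sub>v x = L *\<^sub>v x + R *\<^sub>v (J *\<^sub>v x)" if "x \<in> carrier_vec N" for x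
    unfolding G_def
    using add_mult_distrib_mat_vec[OF carrier(7) RJ that] assoc_mult_mat_vec[OF carrier(2) J that]
    by simp
  have inj: "x = 0\<^sub>v N" if x: "x \<in> carrier_vec N" and Gx0: "G *\<^sub>v x = 0\<^sub>v N" for x
  proof -
    have BJ: "B\<^sup>T *\<^sub>v (J *\<^sub>v x) = 0\<^sub>v K" using consensus[OF Jc[OF x]] Jim[OF x] by simp
    \<comment> \<open>Testing \<open>G x = 0\<close> against \<open>J x\<close>: this vector is a
      consensus vector, so the \<open>L\<close> term drops out and its own dissipation must vanish,
      whence \<open>J x = 0\<close>.\<close>
    have "(J *\<^sub>v x) \<bullet> (G *\<^sub>v x) = (J *\<^sub>v x) \<bullet> (L *\<^sub>v x) + (J *\<^sub>v x) \<bullet> (R *\<^sub>v (J *\<^sub>v x))"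
      unfolding Gx[OF x] by (rule scalar_prod_add_distrib[of _ N]) (use Jc[OF x] Lc[OF x] in auto)
    moreover have "(J *\<^sub>v x) \<bullet> (L *\<^sub>v x) = 0"
      using L_quadratic_form[OF Jc[OF x] x] BJ x by simp
    ultimately have "(J *\<^sub>v x) \<bullet> (R *\<^sub>v (J *\<^sub>v x)) = 0" using Gx0 Jc[OF x] by simp
    then have J0: "J *\<^sub>v x = 0\<^sub>v N" using damped_consensus[OF Jc[OF x] BJ] by simp
    have "R *\<^sub>v 0\<^sub>v N = 0\<^sub>v N" by (intro eq_vecI) auto
    then have "L *\<^sub>v x = 0\<^sub>v N" using Gx[OF x] Gx0 J0 Lc[OF x] by simp
    then have "x \<in> mat_image II" using consensus[OF x] L_kernel[OF x] by simp
    then obtain u where u: "u \<in> carrier_vec r" "x = II *\<^sub>v u" using II by (auto simp: mat_image_def)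
    \<comment> \<open>Now \<open>x\<close> lies in the image of \<open>II\<close>, while
      \<open>J x = 0\<close> makes it orthogonal to that image, so it is orthogonal to
      itself.\<close>
    have "(II\<^sup>T *\<^sub>v x) \<bullet> (II\<^sup>T *\<^sub>v x) = x \<bullet> (J *\<^sub>v x)"
      unfolding Jx[OF x] using mult_mat_vec_scalar_prod[OF II x mult_mat_vec_carrier[OF IIT x]] by simp
    then have "II\<^sup>T *\<^sub>v x = 0\<^sub>v r"
      using scalar_prod_self_zero[OF mult_mat_vec_carrier[OF IIT x]] J0 x by simp
    then have "x \<bullet> x = 0" using mult_mat_vec_scalar_prod[OF II x u(1)] u by simp
    then show ?thesis by (rule scalar_prod_self_zero[OF x])
  qed
  define z where "z = minv G *\<^sub>v v"
  have z: "z \<in> carrier_vec N"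
    unfolding z_def using mult_mat_vec_carrier[OF minv_inverts(1)[OF G inj] v] .
  have "G *\<^sub>v z = v" unfolding z_def by (rule minv_mult_vec(1)[OF G inj v])
  then have "R *\<^sub>v (J *\<^sub>v z) + B *\<^sub>v (W *\<^sub>v (B\<^sup>T *\<^sub>v z)) = v"
    unfolding Gx[OF z] L_mult_vec[OF z] using z Jc[OF z] by (subst comm_add_vec[of _ N]) simp_all
  then show ?thesis using Jim[OF z] z by (intro bexI[of _ "J *\<^sub>v z"] bexI[of _ "B\<^sup>T *\<^sub>v z"]) auto
qed

lemma mat_image_carrier: "x \<in> mat_image II \<Longrightarrow> x \<in> carrier_vec N"
  using II by (auto simp: mat_image_def)

text \<open>The limit is the equilibrium output \<open>yb\<close>, whatever the initial state.
  Shifting by \<open>(M yb, qb)\<close> absorbs \<open>v\<close> in the first equation, and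
  \<open>B\<^sup>T yb = 0\<close> leaves the second one unchanged.\<close>

lemma output_converges:
  assumes free: "unobservable_mode_free N (Mi * L) R" and sol: "msd_solution M R W B v p q"
  shows "\<exists>c\<in>mat_image II. tendsto_vec (\<lambda>t. Mi *\<^sub>v p t) c at_top"
proof -
  obtain yb qb where yb: "yb \<in> mat_image II" and qb: "qb \<in> carrier_vec K"
    and eq: "R *\<^sub>v yb + B *\<^sub>v (W *\<^sub>v qb) = v" using equilibrium by blast
  have ybc: "yb \<in> carrier_vec N" using mat_image_carrier[OF yb] .
  have Byb: "B\<^sup>T *\<^sub>v yb = 0\<^sub>v K" using consensus[OF ybc] yb by simp
  have p: "p t \<in> carrier_vec N" and q: "q t \<in> carrier_vec K"
    and p': "has_deriv_vec p (- (R *\<^sub>v (Mi *\<^sub>v p t)) - B *\<^sub>v (W *\<^sub>v q t) + v) (at t within {0..})"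
    and q': "has_deriv_vec q (B\<^sup>T *\<^sub>v (Mi *\<^sub>v p t)) (at t within {0..})" if "t \<ge> 0" for t
    using sol that by (auto simp: msd_solution_def)
  let ?p = "\<lambda>t. p t - M *\<^sub>v yb" and ?q = "\<lambda>t. q t - qb"
  have Mip: "Mi *\<^sub>v ?p t = Mi *\<^sub>v p t - yb" if "t \<ge> 0" for t
    using mult_minus_distrib_mat_vec[OF carrier(6) p[OF that], of "M *\<^sub>v yb"] ybc by simp
  interpret h: msd_homogeneous N K M R W B ?p ?q
  proof unfold_locales
    fix t :: real assume t: "t \<ge> 0"
    show "?p t \<in> carrier_vec N" "?q t \<in> carrier_vec K" using p q t ybc qb by auto
    have "- (R *\<^sub>v (Mi *\<^sub>v ?p t)) - B *\<^sub>v (W *\<^sub>v ?q t)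
        = - (R *\<^sub>v (Mi *\<^sub>v p t)) - B *\<^sub>v (W *\<^sub>v q t) + (R *\<^sub>v yb + B *\<^sub>v (W *\<^sub>v qb))"
    proof -
      have "R *\<^sub>v (Mi *\<^sub>v ?p t) = R *\<^sub>v (Mi *\<^sub>v p t) - R *\<^sub>v yb"
        unfolding Mip[OF t] using mult_minus_distrib_mat_vec[OF carrier(2) _ ybc] p[OF t] by simp
      moreover have "B *\<^sub>v (W *\<^sub>v ?q t) = B *\<^sub>v (W *\<^sub>v q t) - B *\<^sub>v (W *\<^sub>v qb)"
        using mult_minus_distrib_mat_vec[OF carrier(3) q[OF t] qb] q[OF t] qb
          mult_minus_distrib_mat_vec[OF carrier(4), of "W *\<^sub>v q t" "W *\<^sub>v qb"] by simp
      ultimately show ?thesis using p[OF t] q[OF t] ybc qb by (intro eq_vecI) auto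
    qed
    then have d: "- (R *\<^sub>v (Mi *\<^sub>v ?p t)) - B *\<^sub>v (W *\<^sub>v ?q t)
        = - (R *\<^sub>v (Mi *\<^sub>v p t)) - B *\<^sub>v (W *\<^sub>v q t) + v" by (simp add: eq)
    show "has_deriv_vec ?p (- (R *\<^sub>v (Mi *\<^sub>v ?p t)) - B *\<^sub>v (W *\<^sub>v ?q t)) (at t within {0..})"
      unfolding d using p'[OF t] v ybc
      by (auto simp: has_deriv_vec_def intro!: derivative_eq_intros)
    have "B\<^sup>T *\<^sub>v (Mi *\<^sub>v ?p t) = B\<^sup>T *\<^sub>v (Mi *\<^sub>v p t)"
      unfolding Mip[OF t] using mult_minus_distrib_mat_vec[OF carrier(5) _ ybc] p[OF t] Byb by simp
    then show "has_deriv_vec ?q (B\<^sup>T *\<^sub>v (Mi *\<^sub>v ?p t)) (at t within {0..})"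
      using q'[OF t] qb by (auto simp: has_deriv_vec_def intro!: derivative_eq_intros)
  qed
  have ev: "\<forall>\<^sub>F t in at_top. t \<ge> (0::real)" by (rule eventually_ge_at_top)
  have "((\<lambda>t. (Mi *\<^sub>v p t) $ i) \<longlongrightarrow> yb $ i) at_top" if i: "i < N" for i
  proof -
    have "((\<lambda>t. h.y t $ i + yb $ i) \<longlongrightarrow> 0 + yb $ i) at_top"
      by (intro tendsto_intros h.output_tendsto_0[OF free i])
    then have "((\<lambda>t. h.y t $ i + yb $ i) \<longlongrightarrow> yb $ i) at_top" by simp
    then show ?thesis
      by (rule Lim_transform_eventually[OF _ eventually_mono[OF ev]])
        (use i ybc in \<open>simp add: h.y_def Mip\<close>)
  qed
  then have "tendsto_vec (\<lambda>t. Mi *\<^sub>v p t) yb at_top"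
    using ybc by (simp add: tendsto_vec_def)
  then show ?thesis using yb by blast
qed

text \<open>Symmetry of \<open>M\<close> and \<open>L\<close> makes the eigenvalue real, so the real
  and the imaginary part of the eigenvector each satisfy the equation, and one of them is nonzero.
  Positivity of \<open>c\<close> comes from \<open>damped_consensus\<close>: as
  \<open>R x = 0\<close>, a nonzero \<open>x\<close> cannot lie in the kernel of
  \<open>B\<^sup>T\<close>.\<close>

lemma undamped_real_mode:
  assumes "\<not> unobservable_mode_free N (Mi * L) R"
  shows "\<exists>x\<in>carrier_vec N. \<exists>c>0. x \<noteq> 0\<^sub>v N \<and> R *\<^sub>v x = 0\<^sub>v N \<and> L *\<^sub>v x = c \<cdot>\<^sub>v (M *\<^sub>v x)"
proof -
  obtain \<mu> w where w: "w \<in> carrier_vec N" "cmat (Mi * L) *\<^sub>v w = \<mu> \<cdot>\<^sub>v w"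
    "cmat R *\<^sub>v w = 0\<^sub>v N" "w \<noteq> 0\<^sub>v N"
    using assms by (auto simp: unobservable_mode_free_def)
  have MiL: "Mi * L \<in> carrier_mat N N" using mult_carrier_mat[OF carrier(6,7)] .
  let ?a = "re_vec w" and ?b = "im_vec w" and ?c = "Re \<mu>" and ?d = "Im \<mu>"
  have a: "?a \<in> carrier_vec N" and b: "?b \<in> carrier_vec N" using w by auto
  have Ra: "R *\<^sub>v ?a = 0\<^sub>v N" and Rb: "R *\<^sub>v ?b = 0\<^sub>v N"
    using re_im_cmat_mult_vec[OF carrier(2) w(1)] w(3) by (simp_all add: re_im_zero)
  have Lc: "L *\<^sub>v x \<in> carrier_vec N" if "x \<in> carrier_vec N" for x
    using mult_mat_vec_carrier[OF carrier(7) that] .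
  have eq: "L *\<^sub>v x = M *\<^sub>v ((Mi * L) *\<^sub>v x)" if "x \<in> carrier_vec N" for x
    using assoc_mult_mat_vec[OF carrier(6,7) that] Lc[OF that] by simp
  have "(Mi * L) *\<^sub>v ?a = ?c \<cdot>\<^sub>v ?a - ?d \<cdot>\<^sub>v ?b" "(Mi * L) *\<^sub>v ?b = ?c \<cdot>\<^sub>v ?b + ?d \<cdot>\<^sub>v ?a"
    using re_im_cmat_mult_vec[OF MiL w(1)] w(2) re_im_smult[OF w(1)] by simp_all
  then have La: "L *\<^sub>v ?a = ?c \<cdot>\<^sub>v (M *\<^sub>v ?a) - ?d \<cdot>\<^sub>v (M *\<^sub>v ?b)"
    and Lb: "L *\<^sub>v ?b = ?c \<cdot>\<^sub>v (M *\<^sub>v ?b) + ?d \<cdot>\<^sub>v (M *\<^sub>v ?a)"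
    using eq[OF a] eq[OF b] a b mult_minus_distrib_mat_vec[OF carrier(1)]
      mult_add_distrib_mat_vec[OF carrier(1)] mult_mat_vec[OF carrier(1)] by simp_all
  \<comment> \<open>Expanding the symmetric number \<open>?b . L ?a = ?a . L ?b\<close> in two ways,
    the terms with \<open>?c\<close> cancel; what remains is \<open>?d\<close> times a positive
    number.\<close>
  have "?b \<bullet> (L *\<^sub>v ?a) = ?a \<bullet> (L *\<^sub>v ?b)"
    using quadratic_form_commute(2)[OF b a] .
  moreover have Mab: "?b \<bullet> (M *\<^sub>v ?a) = ?a \<bullet> (M *\<^sub>v ?b)"
    using quadratic_form_commute(1)[OF b a] .
  moreover have "?b \<bullet> (L *\<^sub>v ?a) = ?c * (?b \<bullet> (M *\<^sub>v ?a)) - ?d * (?b \<bullet> (M *\<^sub>v ?b))"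
    unfolding La using a b by (simp add: scalar_prod_minus_distrib[of _ N])
  moreover have "?a \<bullet> (L *\<^sub>v ?b) = ?c * (?a \<bullet> (M *\<^sub>v ?b)) + ?d * (?a \<bullet> (M *\<^sub>v ?a))"
    unfolding Lb using a b by (simp add: scalar_prod_add_distrib[of _ N])
  ultimately have d0: "?d * (?a \<bullet> (M *\<^sub>v ?a) + ?b \<bullet> (M *\<^sub>v ?b)) = 0"
    by (simp add: algebra_simps)
  have ab: "?a \<noteq> 0\<^sub>v N \<or> ?b \<noteq> 0\<^sub>v N"
    using w(4) re_im_vec_eqI[of w "0\<^sub>v N"] by (auto simp: re_im_zero)
  have nn: "0 \<le> x \<bullet> (M *\<^sub>v x)" "x \<noteq> 0\<^sub>v N \<Longrightarrow> 0 < x \<bullet> (M *\<^sub>v x)" if "x \<in> carrier_vec N" for x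
    using that M pos_def_imp_semidef[OF M] unfolding pos_def_mat_def pos_semidef_mat_def by blast+
  have "?a \<bullet> (M *\<^sub>v ?a) + ?b \<bullet> (M *\<^sub>v ?b) > 0"
    using ab nn(1)[OF a] nn(2)[OF a] nn(1)[OF b] nn(2)[OF b] by linarith
  then have d: "?d = 0" using d0 by simp
  obtain x where x: "x \<in> carrier_vec N" "x \<noteq> 0\<^sub>v N" "R *\<^sub>v x = 0\<^sub>v N" "L *\<^sub>v x = ?c \<cdot>\<^sub>v (M *\<^sub>v x)"
  proof (cases "?a = 0\<^sub>v N")
    case True
    have "L *\<^sub>v ?b = ?c \<cdot>\<^sub>v (M *\<^sub>v ?b)"
      unfolding Lb d using a b by (intro eq_vecI) auto
    then show ?thesis using that[OF b] ab True Rb by blast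
  next
    case False
    have "L *\<^sub>v ?a = ?c \<cdot>\<^sub>v (M *\<^sub>v ?a)"
      unfolding La d using a b by (intro eq_vecI) auto
    then show ?thesis using that[OF a] False Ra by blast
  qed
  have "?c * (x \<bullet> (M *\<^sub>v x)) = x \<bullet> (L *\<^sub>v x)" unfolding x(4) using x by simp
  also have "\<dots> = (B\<^sup>T *\<^sub>v x) \<bullet> (W *\<^sub>v (B\<^sup>T *\<^sub>v x))" using L_quadratic_form[OF x(1) x(1)] .
  also have "\<dots> > 0"
  proof -
    have "B\<^sup>T *\<^sub>v x \<noteq> 0\<^sub>v K" using damped_consensus[OF x(1)] x by auto
    then show ?thesis using W x unfolding pos_def_mat_def by simp
  qed
  finally have "?c > 0" using nn(2)[OF x(1,2)] by (simp add: zero_less_mult_iff)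
  then show ?thesis using x by blast
qed

text \<open>An undamped mode superposed on the equilibrium has no limit at all, so (i) fails already
  at convergence and not merely at the location of the limit.\<close>

lemma oscillating_solution:
  assumes "\<not> unobservable_mode_free N (Mi * L) R"
  shows "\<exists>p q. msd_solution M R W B v p q \<and> \<not> (\<exists>c. tendsto_vec (\<lambda>t. Mi *\<^sub>v p t) c at_top)"
proof -
  obtain yb qb where yb: "yb \<in> mat_image II" and qb: "qb \<in> carrier_vec K"
    and eq: "R *\<^sub>v yb + B *\<^sub>v (W *\<^sub>v qb) = v" using equilibrium by blast
  have ybc: "yb \<in> carrier_vec N" using mat_image_carrier[OF yb] .
  have Byb: "B\<^sup>T *\<^sub>v yb = 0\<^sub>v K" using consensus[OF ybc] yb by simp
  obtain x c where x: "x \<in> carrier_vec N" "x \<noteq> 0\<^sub>v N" "R *\<^sub>v x = 0\<^sub>v N" "L *\<^sub>v x = c \<cdot>\<^sub>v (M *\<^sub>v x)"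
    and c: "c > 0" using undamped_real_mode[OF assms] by blast
  define \<omega> where "\<omega> = sqrt c"
  have \<omega>: "\<omega> > 0" "c = \<omega> * \<omega>" using c by (auto simp: \<omega>_def)
  \<comment> \<open>For output \<open>yb + sin (\<omega> t) x\<close> the equation for
    \<open>q\<close> integrates to the cosine term with factor \<open>1 / \<omega>\<close>; the
    momentum equation then requires \<open>L x = \<omega>^2 M x\<close>, which fixes
    \<open>\<omega> = sqrt c\<close>.\<close>
  define p where "p t = M *\<^sub>v yb + sin (\<omega> * t) \<cdot>\<^sub>v (M *\<^sub>v x)" for t
  define q where "q t = qb - (cos (\<omega> * t) / \<omega>) \<cdot>\<^sub>v (B\<^sup>T *\<^sub>v x)" for t
  have Mip: "Mi *\<^sub>v p t = yb + sin (\<omega> * t) \<cdot>\<^sub>v x" for t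
    unfolding p_def using ybc x mult_add_distrib_mat_vec[OF carrier(6), of "M *\<^sub>v yb"]
      mult_mat_vec[OF carrier(6), of "M *\<^sub>v x"] by simp
  have sol: "msd_solution M R W B v p q"
    unfolding msd_solution_def
  proof (intro allI impI conjI)
    fix t :: real
    show "p t \<in> carrier_vec (dim_row B)" "q t \<in> carrier_vec (dim_col B)"
      using ybc qb x by (auto simp: p_def q_def)
    have 1: "R *\<^sub>v (Mi *\<^sub>v p t) = R *\<^sub>v yb"
    proof -
      have "R *\<^sub>v (Mi *\<^sub>v p t) = R *\<^sub>v yb + sin (\<omega> * t) \<cdot>\<^sub>v (R *\<^sub>v x)"
        unfolding Mip using ybc x(1) mult_add_distrib_mat_vec[OF carrier(2), of yb]
          mult_mat_vec[OF carrier(2), of x] by simp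
      then show ?thesis unfolding x(3) using ybc by (intro eq_vecI) auto
    qed
    have "W *\<^sub>v q t = W *\<^sub>v qb - (cos (\<omega> * t) / \<omega>) \<cdot>\<^sub>v (W *\<^sub>v (B\<^sup>T *\<^sub>v x))"
      unfolding q_def using qb x(1) mult_minus_distrib_mat_vec[OF carrier(3), of qb]
        mult_mat_vec[OF carrier(3), of "B\<^sup>T *\<^sub>v x"] by simp
    then have "B *\<^sub>v (W *\<^sub>v q t) = B *\<^sub>v (W *\<^sub>v qb) - (cos (\<omega> * t) / \<omega>) \<cdot>\<^sub>v (L *\<^sub>v x)"
      using qb x(1) mult_minus_distrib_mat_vec[OF carrier(4), of "W *\<^sub>v qb"]
        mult_mat_vec[OF carrier(4), of "W *\<^sub>v (B\<^sup>T *\<^sub>v x)"] by (simp add: L_mult_vec)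
    then have 2: "- (R *\<^sub>v (Mi *\<^sub>v p t)) - B *\<^sub>v (W *\<^sub>v q t) + v = (\<omega> * cos (\<omega> * t)) \<cdot>\<^sub>v (M *\<^sub>v x)"
      unfolding 1 x(4) eq[symmetric] using ybc qb x(1) \<omega>
      by (intro eq_vecI) (auto simp: field_simps)
    show "has_deriv_vec p (- (R *\<^sub>v (Mi *\<^sub>v p t)) - B *\<^sub>v (W *\<^sub>v q t) + v) (at t within {0..})"
      unfolding 2 unfolding p_def[abs_def] has_deriv_vec_def using x(1) ybc
      by (auto intro!: derivative_eq_intros simp del: index_mult_mat_vec)
    have 3: "B\<^sup>T *\<^sub>v (Mi *\<^sub>v p t) = sin (\<omega> * t) \<cdot>\<^sub>v (B\<^sup>T *\<^sub>v x)"
    proof -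
      have "B\<^sup>T *\<^sub>v (Mi *\<^sub>v p t) = B\<^sup>T *\<^sub>v yb + sin (\<omega> * t) \<cdot>\<^sub>v (B\<^sup>T *\<^sub>v x)"
        unfolding Mip using ybc x(1) mult_add_distrib_mat_vec[OF carrier(5), of yb]
          mult_mat_vec[OF carrier(5), of x] by simp
      then show ?thesis unfolding Byb using x(1) by (intro eq_vecI) auto
    qed
    show "has_deriv_vec q (B\<^sup>T *\<^sub>v (Mi *\<^sub>v p t)) (at t within {0..})"
      unfolding 3 unfolding q_def[abs_def] has_deriv_vec_def using x(1) qb \<omega>
      by (auto intro!: derivative_eq_intros simp del: index_mult_mat_vec)
  qed
  obtain i where i: "i < N" "x $ i \<noteq> 0"
    using x(1,2) by (metis carrier_vecD eq_vecI index_zero_vec)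
  have "\<not> tendsto_vec (\<lambda>t. Mi *\<^sub>v p t) l at_top" for l
  proof
    assume t: "tendsto_vec (\<lambda>t. Mi *\<^sub>v p t) l at_top"
    then have "\<forall>\<^sub>F t::real in at_top. N = dim_vec l" by (simp add: tendsto_vec_def)
    then have "N = dim_vec l" by simp
    then have "((\<lambda>t. (Mi *\<^sub>v p t) $ i) \<longlongrightarrow> l $ i) at_top"
      using t i unfolding tendsto_vec_def by blast
    then have "((\<lambda>t. yb $ i + sin (\<omega> * t) * x $ i) \<longlongrightarrow> l $ i) at_top"
      unfolding Mip using i x(1) ybc by simp
    from tendsto_divide[OF tendsto_diff[OF this tendsto_const[of "yb $ i"]] tendsto_const i(2)]
    have "((\<lambda>t. sin (\<omega> * t)) \<longlongrightarrow> (l $ i - yb $ i) / x $ i) at_top" using i by simp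
    then show False using sin_not_convergent[OF \<omega>(1)] by blast
  qed
  then show ?thesis using sol by blast
qed

lemma output_convergence_iff:
  "(\<forall>p q. msd_solution M R W B v p q \<longrightarrow>
      (\<exists>c\<in>mat_image II. tendsto_vec (\<lambda>t. Mi *\<^sub>v p t) c at_top))
    \<longleftrightarrow> unobservable_mode_free N (Mi * L) R"
  using output_converges oscillating_solution by blast

end

subsection \<open>Reduction to the undamped nodes\<close>

text \<open>\<open>k\<close> and \<open>l\<close> count scalar coordinates at damped and undamped
  nodes, that is \<open>nd * r\<close> and \<open>nu * r\<close>, not nodes.\<close>

locale msd_split = msd +
  fixes k l :: nat and Md Mu Rd Ru Bd Bu :: "real mat"
  assumes N: "N = k + l"
    and M_split: "M = block_diag2 Md Mu" and Md: "Md \<in> carrier_mat k k" and Mu: "pos_def_mat l Mu"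
    and R_split: "R = block_diag2 Rd Ru" and Rd: "pos_def_mat k Rd" and Ru: "Ru \<in> carrier_mat l l"
    and B_split: "B = Bd @\<^sub>r Bu" and Bd: "Bd \<in> carrier_mat k K" and Bu: "Bu \<in> carrier_mat l K"
begin

definition Ldu :: "real mat" where "Ldu = Bd * W * Bu\<^sup>T"
definition Luu :: "real mat" where "Luu = Bu * W * Bu\<^sup>T"

lemma split_carrier:
  "Mu \<in> carrier_mat l l" "minv Mu \<in> carrier_mat l l" "Rd \<in> carrier_mat k k"
  "Ldu \<in> carrier_mat k l" "Luu \<in> carrier_mat l l"
proof -
  show c: "Mu \<in> carrier_mat l l" "Rd \<in> carrier_mat k k"
    using Mu Rd by (auto simp: pos_def_mat_def)
  show "minv Mu \<in> carrier_mat l l" using minv_inverts(1)[OF c(1) pos_def_inj[OF Mu]] .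
  show "Ldu \<in> carrier_mat k l" "Luu \<in> carrier_mat l l"
    unfolding Ldu_def Luu_def using Bd Bu carrier(3) by (meson mult_carrier_mat transpose_carrier_mat)+
qed

lemma M_append: "x \<in> carrier_vec k \<Longrightarrow> u \<in> carrier_vec l \<Longrightarrow> M *\<^sub>v (x @\<^sub>v u) = (Md *\<^sub>v x) @\<^sub>v (Mu *\<^sub>v u)"
  unfolding M_split by (rule block_diag2_mult_vec[OF Md split_carrier(1)])

lemma R_append: "x \<in> carrier_vec k \<Longrightarrow> u \<in> carrier_vec l \<Longrightarrow> R *\<^sub>v (x @\<^sub>v u) = (Rd *\<^sub>v x) @\<^sub>v (Ru *\<^sub>v u)"
  unfolding R_split by (rule block_diag2_mult_vec[OF split_carrier(3) Ru])

lemma L_append_zero: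
  assumes u: "u \<in> carrier_vec l"
  shows "L *\<^sub>v (0\<^sub>v k @\<^sub>v u) = (Ldu *\<^sub>v u) @\<^sub>v (Luu *\<^sub>v u)"
proof -
  have zu: "0\<^sub>v k @\<^sub>v u \<in> carrier_vec N" using u N by auto
  have BT: "Bu\<^sup>T \<in> carrier_mat K l" and Bu_u: "Bu\<^sup>T *\<^sub>v u \<in> carrier_vec K"
    using Bu u by (auto intro: mult_mat_vec_carrier)
  have "Bd\<^sup>T *\<^sub>v 0\<^sub>v k = 0\<^sub>v K" using Bd by (intro eq_vecI) auto
  then have "B\<^sup>T *\<^sub>v (0\<^sub>v k @\<^sub>v u) = Bu\<^sup>T *\<^sub>v u"
    unfolding B_split using transpose_append_rows_mult_vec[OF Bd Bu zero_carrier_vec u] Bu_u by simp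
  then have "L *\<^sub>v (0\<^sub>v k @\<^sub>v u) = B *\<^sub>v (W *\<^sub>v (Bu\<^sup>T *\<^sub>v u))" using L_mult_vec[OF zu] by simp
  also have "\<dots> = (Bd *\<^sub>v (W *\<^sub>v (Bu\<^sup>T *\<^sub>v u))) @\<^sub>v (Bu *\<^sub>v (W *\<^sub>v (Bu\<^sup>T *\<^sub>v u)))"
    unfolding B_split using mat_mult_append[OF Bd Bu] Bu_u by simp
  also have "Bd *\<^sub>v (W *\<^sub>v (Bu\<^sup>T *\<^sub>v u)) = Ldu *\<^sub>v u"
    unfolding Ldu_def using assoc_mult_mat_vec[OF mult_carrier_mat[OF Bd carrier(3)] BT u]
      assoc_mult_mat_vec[OF Bd carrier(3) Bu_u] by simp
  also have "Bu *\<^sub>v (W *\<^sub>v (Bu\<^sup>T *\<^sub>v u)) = Luu *\<^sub>v u"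
    unfolding Luu_def using assoc_mult_mat_vec[OF mult_carrier_mat[OF Bu carrier(3)] BT u]
      assoc_mult_mat_vec[OF Bu carrier(3) Bu_u] by simp
  finally show ?thesis .
qed

text \<open>\<open>R\<close> is block diagonal and \<open>Rd\<close> is definite, so the damped
  coordinates of a kernel vector are zero.\<close>

lemma R_kernel:
  assumes x: "x \<in> carrier_vec N" and Rx: "R *\<^sub>v x = 0\<^sub>v N"
  shows "\<exists>u\<in>carrier_vec l. x = 0\<^sub>v k @\<^sub>v u \<and> Ru *\<^sub>v u = 0\<^sub>v l"
proof -
  obtain a b where ab: "x = a @\<^sub>v b" "a \<in> carrier_vec k" "b \<in> carrier_vec l"
    using carrier_vec_split[of x k l] x N by blast
  have "(Rd *\<^sub>v a) @\<^sub>v (Ru *\<^sub>v b) = 0\<^sub>v k @\<^sub>v 0\<^sub>v l"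
    using Rx R_append[OF ab(2,3)] by (simp add: ab(1) N append_zero_vec)
  then have "Rd *\<^sub>v a = 0\<^sub>v k" "Ru *\<^sub>v b = 0\<^sub>v l"
    using append_vec_eq[of "Rd *\<^sub>v a" k "0\<^sub>v k"] mult_mat_vec_carrier[OF split_carrier(3) ab(2)]
    by auto
  then show ?thesis using pos_def_inj[OF Rd ab(2)] ab by auto
qed

lemma cmat_R_kernel:
  assumes w: "w \<in> carrier_vec N" and Rw: "cmat R *\<^sub>v w = 0\<^sub>v N"
  shows "\<exists>u\<in>carrier_vec l. w = 0\<^sub>v k @\<^sub>v u \<and> cmat Ru *\<^sub>v u = 0\<^sub>v l"
proof -
  have "R *\<^sub>v re_vec w = 0\<^sub>v N" "R *\<^sub>v im_vec w = 0\<^sub>v N"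
    using re_im_cmat_mult_vec[OF carrier(2) w] Rw by (simp_all add: re_im_zero)
  then obtain a b where a: "a \<in> carrier_vec l" "re_vec w = 0\<^sub>v k @\<^sub>v a" "Ru *\<^sub>v a = 0\<^sub>v l"
    and b: "b \<in> carrier_vec l" "im_vec w = 0\<^sub>v k @\<^sub>v b" "Ru *\<^sub>v b = 0\<^sub>v l"
    using R_kernel[of "re_vec w"] R_kernel[of "im_vec w"] w by auto
  define u where "u = vec l (\<lambda>i. Complex (a $ i) (b $ i))"
  have u: "u \<in> carrier_vec l" "re_vec u = a" "im_vec u = b"
    using a(1) b(1) by (auto simp: u_def intro!: eq_vecI)
  have "w = 0\<^sub>v k @\<^sub>v u"
    by (rule re_im_vec_eqI) (simp_all add: re_im_append re_im_zero u a b)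
  moreover have "cmat Ru *\<^sub>v u = 0\<^sub>v l"
    by (rule re_im_vec_eqI) (simp_all add: re_im_cmat_mult_vec[OF Ru u(1)] re_im_zero u a b)
  ultimately show ?thesis using u(1) by blast
qed

lemma cmat_R_append_zero:
  assumes u: "u \<in> carrier_vec l" and Ru0: "cmat Ru *\<^sub>v u = 0\<^sub>v l"
  shows "cmat R *\<^sub>v (0\<^sub>v k @\<^sub>v u) = 0\<^sub>v N"
proof (rule re_im_vec_eqI)
  have c: "0\<^sub>v k @\<^sub>v u \<in> carrier_vec N" using u N by auto
  have "Ru *\<^sub>v re_vec u = 0\<^sub>v l" "Ru *\<^sub>v im_vec u = 0\<^sub>v l"
    using re_im_cmat_mult_vec[OF Ru u] Ru0 by (simp_all add: re_im_zero)
  moreover have "Rd *\<^sub>v 0\<^sub>v k = 0\<^sub>v k" using split_carrier(3) by (intro eq_vecI) auto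
  ultimately show "re_vec (cmat R *\<^sub>v (0\<^sub>v k @\<^sub>v u)) = re_vec (0\<^sub>v N)"
    "im_vec (cmat R *\<^sub>v (0\<^sub>v k @\<^sub>v u)) = im_vec (0\<^sub>v N)"
    using u R_append[of "0\<^sub>v k"]
    by (simp_all add: re_im_cmat_mult_vec[OF carrier(2) c] re_im_append re_im_zero N append_zero_vec)
qed

context
  fixes D Lt :: "real mat"
  assumes Lt: "Lt = Luu - Ldu\<^sup>T * D * Ldu"
begin

lemma Lt_carrier: "Lt \<in> carrier_mat l l" "minv Mu * Lt \<in> carrier_mat l l"
  using split_carrier unfolding Lt by (auto intro!: mult_carrier_mat[of _ l l])

text \<open>On the kernel of \<open>Ldu\<close> the Schur correction
  \<open>Ldu\<^sup>T * D * Ldu\<close> vanishes for every \<open>D\<close>, so \<open>Lt\<close>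
  acts as \<open>Luu\<close>; and there \<open>L\<close> maps \<open>(0, u)\<close> to
  \<open>(0, Luu u)\<close>, on which \<open>Mi\<close> acts through \<open>minv Mu\<close>.\<close>

lemma reduced_mult_vec:
  assumes u: "u \<in> carrier_vec l" and Ldu0: "Ldu *\<^sub>v u = 0\<^sub>v k"
  shows "(Mi * L) *\<^sub>v (0\<^sub>v k @\<^sub>v u) = 0\<^sub>v k @\<^sub>v ((minv Mu * Lt) *\<^sub>v u)"
proof -
  have zu: "0\<^sub>v k @\<^sub>v u \<in> carrier_vec N" using u N by auto
  have X: "Ldu\<^sup>T * D * Ldu \<in> carrier_mat l l" using split_carrier by auto
  have Luu_u: "Luu *\<^sub>v u \<in> carrier_vec l" using mult_mat_vec_carrier[OF split_carrier(5) u] .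
  have "(Ldu\<^sup>T * D * Ldu) *\<^sub>v u = 0\<^sub>v l"
    using mult_mat_vec_eq_0[of u Ldu "Ldu\<^sup>T * D"] split_carrier(4) u Ldu0 by auto
  then have "Lt *\<^sub>v u = Luu *\<^sub>v u"
    unfolding Lt using minus_mult_distrib_mat_vec[OF split_carrier(5) X u] Luu_u by simp
  then have E: "(minv Mu * Lt) *\<^sub>v u = minv Mu *\<^sub>v (Luu *\<^sub>v u)"
    using assoc_mult_mat_vec[OF split_carrier(2) Lt_carrier(1) u] by simp
  have e: "minv Mu *\<^sub>v (Luu *\<^sub>v u) \<in> carrier_vec l"
    using mult_mat_vec_carrier[OF split_carrier(2) Luu_u] .
  have "Md *\<^sub>v 0\<^sub>v k = 0\<^sub>v k" using Md by (intro eq_vecI) auto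
  then have "M *\<^sub>v (0\<^sub>v k @\<^sub>v (minv Mu *\<^sub>v (Luu *\<^sub>v u))) = 0\<^sub>v k @\<^sub>v (Luu *\<^sub>v u)"
    using M_append[OF zero_carrier_vec e] minv_mult_vec(1)[OF split_carrier(1) pos_def_inj[OF Mu] Luu_u]
    by simp
  also have "\<dots> = L *\<^sub>v (0\<^sub>v k @\<^sub>v u)" using L_append_zero[OF u] Ldu0 by simp
  finally have "Mi *\<^sub>v (L *\<^sub>v (0\<^sub>v k @\<^sub>v u)) = 0\<^sub>v k @\<^sub>v (minv Mu *\<^sub>v (Luu *\<^sub>v u))"
    using M_Mi(2)[of "0\<^sub>v k @\<^sub>v (minv Mu *\<^sub>v (Luu *\<^sub>v u))"] e N by (metis append_carrier_vec zero_carrier_vec)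
  then show ?thesis using assoc_mult_mat_vec[OF carrier(6,7) zu] E by simp
qed

text \<open>If \<open>Mi L\<close> keeps the damped coordinates at zero, then so does
  \<open>L\<close>, since \<open>M\<close> is block diagonal; the damped block of
  \<open>L (0, u)\<close> is \<open>Ldu u\<close>. The vector \<open>z\<close> is left general so
  that the real and imaginary parts of \<open>\<mu> u\<close> can be inserted separately.\<close>

lemma undamped_invariance:
  assumes u: "u \<in> carrier_vec l" and z: "z \<in> carrier_vec l"
    and eq: "(Mi * L) *\<^sub>v (0\<^sub>v k @\<^sub>v u) = 0\<^sub>v k @\<^sub>v z"
  shows "Ldu *\<^sub>v u = 0\<^sub>v k"
proof -
  have zu: "0\<^sub>v k @\<^sub>v u \<in> carrier_vec N" using u N by auto
  have Lzu: "L *\<^sub>v (0\<^sub>v k @\<^sub>v u) \<in> carrier_vec N" using mult_mat_vec_carrier[OF carrier(7) zu] .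
  have "L *\<^sub>v (0\<^sub>v k @\<^sub>v u) = M *\<^sub>v ((Mi * L) *\<^sub>v (0\<^sub>v k @\<^sub>v u))"
    using assoc_mult_mat_vec[OF carrier(6,7) zu] Lzu by simp
  also have "\<dots> = 0\<^sub>v k @\<^sub>v (Mu *\<^sub>v z)"
  proof -
    have "Md *\<^sub>v 0\<^sub>v k = 0\<^sub>v k" using Md by (intro eq_vecI) auto
    then show ?thesis unfolding eq using M_append[OF zero_carrier_vec z] by simp
  qed
  finally show ?thesis
    using L_append_zero[OF u] append_vec_eq[OF mult_mat_vec_carrier[OF split_carrier(4) u] zero_carrier_vec]
    by simp
qed

lemma cmat_reduced_mult_vec:
  assumes u: "u \<in> carrier_vec l" and Ldu0: "cmat Ldu *\<^sub>v u = 0\<^sub>v k"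
  shows "cmat (Mi * L) *\<^sub>v (0\<^sub>v k @\<^sub>v u) = 0\<^sub>v k @\<^sub>v (cmat (minv Mu * Lt) *\<^sub>v u)"
proof (rule re_im_vec_eqI)
  have c: "0\<^sub>v k @\<^sub>v u \<in> carrier_vec N" using u N by auto
  have MiL: "Mi * L \<in> carrier_mat N N" using mult_carrier_mat[OF carrier(6,7)] .
  have "Ldu *\<^sub>v re_vec u = 0\<^sub>v k" "Ldu *\<^sub>v im_vec u = 0\<^sub>v k"
    using re_im_cmat_mult_vec[OF split_carrier(4) u] Ldu0 by (simp_all add: re_im_zero)
  then show "re_vec (cmat (Mi * L) *\<^sub>v (0\<^sub>v k @\<^sub>v u)) = re_vec (0\<^sub>v k @\<^sub>v (cmat (minv Mu * Lt) *\<^sub>v u))"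
    "im_vec (cmat (Mi * L) *\<^sub>v (0\<^sub>v k @\<^sub>v u)) = im_vec (0\<^sub>v k @\<^sub>v (cmat (minv Mu * Lt) *\<^sub>v u))"
    using u reduced_mult_vec[of "re_vec u"] reduced_mult_vec[of "im_vec u"]
    unfolding re_im_cmat_mult_vec[OF MiL c] re_im_append re_im_zero
      re_im_cmat_mult_vec[OF Lt_carrier(2) u] by simp_all
qed

lemma cmat_undamped_invariance:
  assumes u: "u \<in> carrier_vec l" and eq: "cmat (Mi * L) *\<^sub>v (0\<^sub>v k @\<^sub>v u) = \<mu> \<cdot>\<^sub>v (0\<^sub>v k @\<^sub>v u)"
  shows "cmat Ldu *\<^sub>v u = 0\<^sub>v k"
proof -
  have c: "0\<^sub>v k @\<^sub>v u \<in> carrier_vec N" using u N by auto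
  have MiL: "Mi * L \<in> carrier_mat N N" using mult_carrier_mat[OF carrier(6,7)] .
  have "\<mu> \<cdot>\<^sub>v (0\<^sub>v k @\<^sub>v u) = 0\<^sub>v k @\<^sub>v (\<mu> \<cdot>\<^sub>v u)" using u by (intro eq_vecI) auto
  then have eq': "cmat (Mi * L) *\<^sub>v (0\<^sub>v k @\<^sub>v u) = 0\<^sub>v k @\<^sub>v (\<mu> \<cdot>\<^sub>v u)" using eq by simp
  have "(Mi * L) *\<^sub>v (0\<^sub>v k @\<^sub>v re_vec u) = 0\<^sub>v k @\<^sub>v re_vec (\<mu> \<cdot>\<^sub>v u)"
    "(Mi * L) *\<^sub>v (0\<^sub>v k @\<^sub>v im_vec u) = 0\<^sub>v k @\<^sub>v im_vec (\<mu> \<cdot>\<^sub>v u)"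
    using re_im_cmat_mult_vec[OF MiL c] unfolding eq' re_im_append re_im_zero by simp_all
  then have "Ldu *\<^sub>v re_vec u = 0\<^sub>v k" "Ldu *\<^sub>v im_vec u = 0\<^sub>v k"
    using undamped_invariance[of "re_vec u" "re_vec (\<mu> \<cdot>\<^sub>v u)"]
      undamped_invariance[of "im_vec u" "im_vec (\<mu> \<cdot>\<^sub>v u)"] u by simp_all
  then show ?thesis
    by (intro re_im_vec_eqI) (simp_all add: re_im_cmat_mult_vec[OF split_carrier(4) u] re_im_zero)
qed

text \<open>The map from \<open>u\<close> to \<open>(0, u)\<close> matches eigenvectors of the
  reduced matrix in the kernels of \<open>Ldu\<close> and \<open>Ru\<close> with eigenvectors of
  \<open>Mi L\<close> in the kernel of \<open>R\<close>, for the same \<open>\<mu>\<close>. Lying in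
  the kernel of \<open>Ldu\<close> is the condition that the damped nodes stay at rest.\<close>

lemma mode_free_iff_reduced:
  "unobservable_mode_free N (Mi * L) R \<longleftrightarrow>
    (\<forall>\<mu>\<in>spectrum (cmat (minv Mu * Lt)).
      mat_kernel (cmat (minv Mu * Lt) - \<mu> \<cdot>\<^sub>m 1\<^sub>m l) \<inter> mat_kernel (cmat (Ldu @\<^sub>r Ru)) = {0\<^sub>v l})"
proof -
  have ker: "u \<in> mat_kernel (cmat (Ldu @\<^sub>r Ru)) \<longleftrightarrow> cmat Ldu *\<^sub>v u = 0\<^sub>v k \<and> cmat Ru *\<^sub>v u = 0\<^sub>v l"
    if u: "u \<in> carrier_vec l" for u
  proof -
    have "cmat (Ldu @\<^sub>r Ru) \<in> carrier_mat (k + l) l" using split_carrier(4) Ru by auto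
    moreover have "cmat Ldu *\<^sub>v u \<in> carrier_vec k"
      using mult_mat_vec_carrier[OF _ u, of "cmat Ldu" k] split_carrier(4) by simp
    ultimately show ?thesis
      using u append_vec_eq[of "cmat Ldu *\<^sub>v u" k "0\<^sub>v k" "cmat Ru *\<^sub>v u" "0\<^sub>v l"]
      by (simp add: append_zero_vec mat_kernel_def cmat_append_rows_mult_vec[OF split_carrier(4) Ru u]
          carrier_matD)
  qed
  have zero: "0\<^sub>v l \<in> mat_kernel (cmat (Ldu @\<^sub>r Ru))"
    unfolding ker[OF zero_carrier_vec] using split_carrier(4) Ru by (auto intro!: eq_vecI)
  have E: "cmat (minv Mu * Lt) \<in> carrier_mat l l" using Lt_carrier(2) by simp
  show ?thesis unfolding no_eigenvector_in_iff[OF E zero] unobservable_mode_free_def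
  proof (intro iffI allI impI)
    fix \<mu> u
    assume free: "\<forall>\<mu> w. w \<in> carrier_vec N \<longrightarrow> cmat (Mi * L) *\<^sub>v w = \<mu> \<cdot>\<^sub>v w \<longrightarrow>
        cmat R *\<^sub>v w = 0\<^sub>v N \<longrightarrow> w = 0\<^sub>v N"
      and u: "u \<in> carrier_vec l" "cmat (minv Mu * Lt) *\<^sub>v u = \<mu> \<cdot>\<^sub>v u"
      "u \<in> mat_kernel (cmat (Ldu @\<^sub>r Ru))"
    have u0: "cmat Ldu *\<^sub>v u = 0\<^sub>v k" "cmat Ru *\<^sub>v u = 0\<^sub>v l" using ker[OF u(1)] u(3) by auto
    have "\<mu> \<cdot>\<^sub>v (0\<^sub>v k @\<^sub>v u) = 0\<^sub>v k @\<^sub>v (\<mu> \<cdot>\<^sub>v u)" using u by (intro eq_vecI) auto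
    then have "cmat (Mi * L) *\<^sub>v (0\<^sub>v k @\<^sub>v u) = \<mu> \<cdot>\<^sub>v (0\<^sub>v k @\<^sub>v u)"
      using cmat_reduced_mult_vec[OF u(1) u0(1)] u(2) by simp
    then have "0\<^sub>v k @\<^sub>v u = 0\<^sub>v N"
      using free cmat_R_append_zero[OF u(1) u0(2)] append_carrier_vec[OF zero_carrier_vec u(1), of k, folded N]
      by blast
    then have "0\<^sub>v k @\<^sub>v u = 0\<^sub>v k @\<^sub>v 0\<^sub>v l" by (simp add: N append_zero_vec)
    then show "u = 0\<^sub>v l" using append_vec_eq[of "0\<^sub>v k" k "0\<^sub>v k" u "0\<^sub>v l"] by simp
  next
    fix \<mu> w
    assume r: "\<forall>\<mu> w. w \<in> carrier_vec l \<longrightarrow> cmat (minv Mu * Lt) *\<^sub>v w = \<mu> \<cdot>\<^sub>v w \<longrightarrow>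
        w \<in> mat_kernel (cmat (Ldu @\<^sub>r Ru)) \<longrightarrow> w = 0\<^sub>v l"
      and w: "w \<in> carrier_vec N" "cmat (Mi * L) *\<^sub>v w = \<mu> \<cdot>\<^sub>v w" "cmat R *\<^sub>v w = 0\<^sub>v N"
    obtain u where u: "u \<in> carrier_vec l" "w = 0\<^sub>v k @\<^sub>v u" "cmat Ru *\<^sub>v u = 0\<^sub>v l"
      using cmat_R_kernel[OF w(1,3)] by blast
    have Ldu0: "cmat Ldu *\<^sub>v u = 0\<^sub>v k"
      using cmat_undamped_invariance[OF u(1)] w(2) u(2) by blast
    have "\<mu> \<cdot>\<^sub>v (0\<^sub>v k @\<^sub>v u) = 0\<^sub>v k @\<^sub>v (\<mu> \<cdot>\<^sub>v u)" using u by (intro eq_vecI) auto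
    then have "0\<^sub>v k @\<^sub>v (cmat (minv Mu * Lt) *\<^sub>v u) = 0\<^sub>v k @\<^sub>v (\<mu> \<cdot>\<^sub>v u)"
      using cmat_reduced_mult_vec[OF u(1) Ldu0] w(2) u(2) by simp
    then have "cmat (minv Mu * Lt) *\<^sub>v u = \<mu> \<cdot>\<^sub>v u"
      using append_vec_eq[of "0\<^sub>v k" k "0\<^sub>v k" "cmat (minv Mu * Lt) *\<^sub>v u" "\<mu> \<cdot>\<^sub>v u"] by simp
    then have "u = 0\<^sub>v l" using r u ker[OF u(1)] Ldu0 by blast
    then show "w = 0\<^sub>v N" by (simp add: u(2) N append_zero_vec)
  qed
qed

end

text \<open>By \<open>cmat_R_kernel\<close> a vector in the kernel of \<open>R\<close> lies in the
  image of the undamped coordinates, so the set \<open>?Q\<close> is the one that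
  \<open>unobservable_mode_free\<close> speaks of.\<close>

lemma mode_free_iff_full:
  "unobservable_mode_free N (Mi * L) R \<longleftrightarrow>
    (\<forall>\<mu>\<in>spectrum (cmat (Mi * L)).
      mat_kernel (cmat (Mi * L) - \<mu> \<cdot>\<^sub>m 1\<^sub>m N) \<inter> mat_kernel (cmat R)
        \<inter> mat_image (cmat (0\<^sub>m k l @\<^sub>r 1\<^sub>m l)) = {0\<^sub>v N})"
proof -
  let ?Q = "mat_kernel (cmat R) \<inter> mat_image (cmat (0\<^sub>m k l @\<^sub>r 1\<^sub>m l))"
  have im: "mat_image (cmat (0\<^sub>m k l @\<^sub>r 1\<^sub>m l)) = {0\<^sub>v k @\<^sub>v u | u. u \<in> carrier_vec l}"
  proof -
    have "cmat (0\<^sub>m k l @\<^sub>r 1\<^sub>m l) *\<^sub>v u = 0\<^sub>v k @\<^sub>v u" if u: "u \<in> carrier_vec l" for u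
    proof -
      have "cmat (0\<^sub>m k l) = 0\<^sub>m k l" "cmat (1\<^sub>m l) = 1\<^sub>m l" by (auto intro!: eq_matI)
      then have "cmat (0\<^sub>m k l) *\<^sub>v u = 0\<^sub>v k" "cmat (1\<^sub>m l) *\<^sub>v u = u"
        using u by (auto intro!: eq_vecI)
      then show ?thesis using cmat_append_rows_mult_vec[OF zero_carrier_mat one_carrier_mat u, of k] by simp
    qed
    moreover have "dim_col (cmat (0\<^sub>m k l @\<^sub>r 1\<^sub>m l)) = l" by (simp add: append_rows_def)
    ultimately show ?thesis unfolding mat_image_def by (auto simp: image_def)
  qed
  have ker: "w \<in> mat_kernel (cmat R) \<longleftrightarrow> w \<in> carrier_vec N \<and> cmat R *\<^sub>v w = 0\<^sub>v N" for w
    by (simp add: mat_kernel_def)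
  have Q: "w \<in> ?Q \<longleftrightarrow> w \<in> carrier_vec N \<and> cmat R *\<^sub>v w = 0\<^sub>v N" for w
    using cmat_R_kernel[of w] by (auto simp: ker im)
  have zero: "0\<^sub>v N \<in> ?Q" unfolding Q using carrier(2) by (auto intro!: eq_vecI)
  have MiL: "cmat (Mi * L) \<in> carrier_mat N N" using mult_carrier_mat[OF carrier(6,7)] by simp
  show ?thesis
    unfolding Int_assoc no_eigenvector_in_iff[OF MiL zero] Q unobservable_mode_free_def by blast
qed

end

section \<open>The equivalence for the network with damped nodes ordered first\<close>

theorem theorem4p9:
  fixes n m r nd nu :: nat
    and E :: "nat set set" and es :: "nat set list"
    and B BB Bd Bu II M R W Mu Ru L Ldd Ldu Luu Ltu :: "real mat"
    and Mb Rb Wb :: "nat \<Rightarrow> real mat"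
    and v :: "real vec"
  assumes graph: "connected_graph {..<n} E"
    and edges: "distinct es" "set es = E" "length es = m"
    and incidence: "oriented_incidence_mat n es B"
    and r: "r \<ge> 1"
    and BB: "BB = B \<otimes>\<^sub>K 1\<^sub>m r"
    and II: "II = mat n 1 (\<lambda>_. 1) \<otimes>\<^sub>K 1\<^sub>m r"
    and Mb: "\<And>i. i < n \<Longrightarrow> pos_def_mat r (Mb i)"
    and Rb: "\<And>i. i < n \<Longrightarrow> pos_semidef_mat r (Rb i)"
    and Wb: "\<And>k. k < m \<Longrightarrow> pos_def_mat r (Wb k)"
    and M: "M = diag_block_mat (map Mb [0..<n])"
    and R: "R = diag_block_mat (map Rb [0..<n])"
    and W: "W = diag_block_mat (map Wb [0..<m])"
    and v: "v \<in> carrier_vec (n * r)"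
    and damped: "{i. i < n \<and> pos_def_mat r (Rb i)} = {..<nd}" "nd \<ge> 1"
    and nu: "nu = n - nd"
    and Mu: "Mu = diag_block_mat (map Mb [nd..<n])"
    and Ru: "Ru = diag_block_mat (map Rb [nd..<n])"
    and Bdu: "Bd \<in> carrier_mat (nd * r) (m * r)" "Bu \<in> carrier_mat (nu * r) (m * r)"
             "BB = Bd @\<^sub>r Bu"
    and L: "L = BB * W * BB\<^sup>T"
    and Ldd: "Ldd = Bd * W * Bd\<^sup>T"
    and Ldu: "Ldu = Bd * W * Bu\<^sup>T"
    and Luu: "Luu = Bu * W * Bu\<^sup>T"
    and Ltu: "Ltu = Luu - Ldu\<^sup>T * minv Ldd * Ldu"
  shows
    "((\<forall>p q. msd_solution M R W BB v p q \<longrightarrow>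
         (\<exists>c \<in> mat_image II. tendsto_vec (\<lambda>t. minv M *\<^sub>v p t) c at_top))
      \<longleftrightarrow>
      (\<forall>\<mu> \<in> spectrum (cmat (minv Mu * Ltu)).
         mat_kernel (cmat (minv Mu * Ltu) - \<mu> \<cdot>\<^sub>m 1\<^sub>m (nu * r)) \<inter> mat_kernel (cmat (Ldu @\<^sub>r Ru))
           = {0\<^sub>v (nu * r)}))
     \<and>
     ((\<forall>\<mu> \<in> spectrum (cmat (minv Mu * Ltu)).
         mat_kernel (cmat (minv Mu * Ltu) - \<mu> \<cdot>\<^sub>m 1\<^sub>m (nu * r)) \<inter> mat_kernel (cmat (Ldu @\<^sub>r Ru))
           = {0\<^sub>v (nu * r)})
      \<longleftrightarrow>
      (\<forall>\<mu> \<in> spectrum (cmat (minv M * L)).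
         mat_kernel (cmat (minv M * L) - \<mu> \<cdot>\<^sub>m 1\<^sub>m (n * r)) \<inter> mat_kernel (cmat R)
           \<inter> mat_image (cmat (0\<^sub>m (nd * r) (nu * r) @\<^sub>r 1\<^sub>m (nu * r)))
           = {0\<^sub>v (n * r)}))"
proof -
  have n: "n > 0" using graph by (auto simp: connected_graph_def)
  have "{..<nd} \<subseteq> {..<n}" unfolding damped(1)[symmetric] by auto
  then have nd: "nd \<le> n" by simp
  have nr: "n * r = nd * r + nu * r" using nd nu by (metis add_mult_distrib le_add_diff_inverse)
  let ?Md = "diag_block_mat (map Mb [0..<nd])" and ?Rd = "diag_block_mat (map Rb [0..<nd])"
  \<comment> \<open>As the damped nodes come first, the node list splits at \<open>nd\<close>, and
    the block-diagonal matrices split with it.\<close>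
  have upt: "[0..<n] = [0..<nd] @ [nd..<n]" using nd upt_add_eq_append[of 0 nd "n - nd"] by simp
  have M_split: "M = block_diag2 ?Md Mu" and R_split: "R = block_diag2 ?Rd Ru"
    unfolding M R Mu Ru upt map_append diag_block_mat_append Let_def by simp_all
  have Md: "pos_def_mat (nd * r) ?Md" and Mu': "pos_def_mat (nu * r) Mu"
    and M': "pos_def_mat (n * r) M"
    unfolding M Mu nu
    using pos_def_diag_block_mat[of "map Mb [0..<nd]" r] pos_def_diag_block_mat[of "map Mb [nd..<n]" r]
      pos_def_diag_block_mat[of "map Mb [0..<n]" r] Mb nd by auto
  have Rdb: "pos_def_mat r (Rb i)" if "i < nd" for i using damped(1) that by auto
  have Rd: "pos_def_mat (nd * r) ?Rd"
    using pos_def_diag_block_mat[of "map Rb [0..<nd]" r] Rdb by auto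
  have Ru': "pos_semidef_mat (nu * r) Ru" and R': "pos_semidef_mat (n * r) R"
    unfolding R Ru nu
    using pos_semidef_diag_block_mat[of "map Rb [nd..<n]" r]
      pos_semidef_diag_block_mat[of "map Rb [0..<n]" r] Rb by auto
  have W': "pos_def_mat (m * r) W"
    unfolding W using pos_def_diag_block_mat[of "map Wb [0..<m]" r] Wb by auto
  have BBc: "BB \<in> carrier_mat (n * r) (m * r)"
    using incidence edges(3) unfolding BB oriented_incidence_mat_def by (auto simp: kronecker_mat_def)
  interpret s: msd_split "n * r" "m * r" M R W BB "nd * r" "nu * r" ?Md Mu ?Rd Ru Bd Bu
    using nr M_split Md Mu' R_split Rd Ru' Bdu
    and M' R' W' BBc
    by unfold_locales (auto simp: pos_def_mat_def pos_semidef_mat_def)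
  have ker: "BB\<^sup>T *\<^sub>v x = 0\<^sub>v (m * r) \<longleftrightarrow> x \<in> mat_image II" if "x \<in> carrier_vec (n * r)" for x
    unfolding BB II edges(3)[symmetric]
    using incidence_kernel_iff[OF graph[folded edges(2)] incidence that] .
  \<comment> \<open>Being in the image of \<open>II\<close>, \<open>x\<close> repeats its first
    \<open>r\<close> entries at every node; being in the kernel of \<open>R\<close>, it vanishes at
    damped nodes. As \<open>nd \<ge> 1\<close>, the first \<open>r\<close> entries belong to a
    damped node, so all entries are zero.\<close>
  have dc: "x = 0\<^sub>v (n * r)"
    if x: "x \<in> carrier_vec (n * r)" and Bx: "BB\<^sup>T *\<^sub>v x = 0\<^sub>v (m * r)" and xRx: "x \<bullet> (R *\<^sub>v x) = 0" for x
  proof -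
    have "R *\<^sub>v x = 0\<^sub>v (n * r)" using pos_semidef_kernel[OF R' x xRx] .
    then obtain b where b: "b \<in> carrier_vec (nu * r)" "x = 0\<^sub>v (nd * r) @\<^sub>v b"
      using s.R_kernel[OF x] by blast
    have dimI: "dim_col II = r" "dim_row II = n * r" by (auto simp: II kronecker_mat_def)
    obtain u where u: "u \<in> carrier_vec r" "x = II *\<^sub>v u"
      using ker[OF x] Bx unfolding mat_image_def dimI by blast
    have xj: "x $ j = u $ (j mod r)" if "j < n * r" for j
      unfolding u(2) II using ones_kronecker_mult_vec[OF u(1) that] .
    show ?thesis
    proof (intro eq_vecI)
      fix j assume "j < dim_vec (0\<^sub>v (n * r) :: real vec)"
      then have j: "j < n * r" by simp
      have jr: "j mod r < r" using r by simp
      have "r \<le> nd * r" "r \<le> n * r" using damped(2) n by simp_all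
      then have lt: "j mod r < nd * r" "j mod r < n * r" using jr by linarith+
      have "x $ j = x $ (j mod r)" using xj[OF j] xj[OF lt(2)] by simp
      also have "\<dots> = 0" using lt b by simp
      finally show "x $ j = 0\<^sub>v (n * r) $ j" using j by simp
    qed (use x in simp)
  qed
  interpret net: msd_network "n * r" "m * r" M R W BB r II v
    using v ker dc by unfold_locales (auto simp: II kronecker_mat_def)
  have Ltu': "Ltu = s.Luu - s.Ldu\<^sup>T * minv Ldd * s.Ldu"
    unfolding Ltu Luu Ldu s.Luu_def s.Ldu_def ..
  show ?thesis
    unfolding L
    using net.output_convergence_iff s.mode_free_iff_reduced[OF Ltu'] s.mode_free_iff_full
    unfolding s.Ldu_def Ldu[symmetric] by blast
qed

end
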